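(* Let $n\ge1$. Hopf vector fields minimize $\mathcal{B}_n$ on the unit round sphere $\mathbb{S}^{2n+1}$: if $H$ is a Hopf vector field on $\mathbb{S}^{2n+1}$, then $\mathcal{B}_n(H)\le\mathcal{B}_n(\vec v)$ for every smooth unit vector field $\vec v$ on $\mathbb{S}^{2n+1}$.
   Context: A Hopf vector field on $\mathbb{S}^{2n+1}\subset\mathbb{R}^{2n+2}$ is a smooth unit vector field tangent to the fibers of a Hopf fibration $\mathbb{S}^1\hookrightarrow\mathbb{S}^{2n+1}\to\mathbb{C}\mathrm{P}^n$, i.e. $H(x)=Jx$ for an orthogonal complex structure $J$ on $\mathbb{R}^{2n+2}$. For a smooth unit vector field $\vec v$ on a compact oriented Riemannian manifold $M^m$ with Levi-Civita connection $\nabla$, regard $\nabla\vec v$ as the endomorphism $X\mapsto\nabla_X\vec v$ of $TM$. For $1\le k\le m-1$, $$\mathcal{B}_k(\vec v)=\int_M\|\underbrace{\nabla\vec v\wedge\cdots\wedge\nabla\vec v}_{k\text{ times}}\|^2=\int_M\sum_{A_1<\cdots<A_k,\ B_1<\cdots<B_k}\det{}^2\big(a^{A_1\cdots A_k}_{B_1\cdots B_k}\big),$$ where, in a local orthonormal frame $\{e_1,\dots,e_m\}$, $a_{AB}=\langle\nabla_{e_B}\vec v,e_A\rangle$, and $a^{A_1\cdots A_k}_{B_1\cdots B_k}$ is the $k\times k$ submatrix of $(a_{AB})$ with rows $A_1,\dots,A_k$ and columns $B_1,\dots,B_k$. Here $M=\mathbb{S}^{2n+1}$, $m=2n+1$ and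 $k=n$. *)

theory Defs
  imports "HOL-Analysis.Analysis" "Jordan_Normal_Form.Determinant" "Jordan_Normal_Form.DL_Submatrix"
begin

no_notation Matrix.scalar_prod (infix "\<bullet>" 70)

section \<open>Smooth maps\<close>

text \<open>Meaningful for open \<open>U\<close> in a finite-dimensional space: all iterated directional derivatives
  up to order \<open>k\<close> exist and are continuous on \<open>U\<close>.\<close>

primrec Ck_on :: "nat \<Rightarrow> 'a::euclidean_space set \<Rightarrow> ('a \<Rightarrow> 'b::real_normed_vector) \<Rightarrow> bool" where
  "Ck_on 0 U f \<longleftrightarrow> continuous_on U f"
| "Ck_on (Suc k) U f \<longleftrightarrow> (\<forall>x\<in>U. f differentiable (at x)) \<and>
     (\<forall>h. Ck_on k U (\<lambda>x. frechet_derivative f (at x) h))"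

definition smooth_on :: "'a::euclidean_space set \<Rightarrow> ('a \<Rightarrow> 'b::real_normed_vector) \<Rightarrow> bool" where
  "smooth_on U f \<longleftrightarrow> (\<forall>k. Ck_on k U f)"

text \<open>Smoothness of a map given on the unit sphere: near every point it is the restriction of a
  smooth map on an open subset of the ambient space.\<close>

definition smooth_on_sphere :: "('a::euclidean_space \<Rightarrow> 'b::real_normed_vector) \<Rightarrow> bool" where
  "smooth_on_sphere f \<longleftrightarrow> (\<forall>x\<in>sphere 0 1. \<exists>U g. open U \<and> x \<in> U \<and> smooth_on U g \<and>
     (\<forall>y\<in>U \<inter> sphere 0 1. g y = f y))"


section \<open>The round unit sphere\<close>

text \<open>Vector fields on the sphere are maps from the ambient space to itself of which only the
  values on the unit sphere matter.\<close>

definition tangent_space :: "'a::euclidean_space \<Rightarrow> 'a set" where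
  "tangent_space x = {X. X \<bullet> x = 0}"

definition smooth_tangent_field :: "('a::euclidean_space \<Rightarrow> 'a) \<Rightarrow> bool" where
  "smooth_tangent_field v \<longleftrightarrow> smooth_on_sphere v \<and> (\<forall>x\<in>sphere 0 1. v x \<in> tangent_space x)"

definition smooth_unit_field :: "('a::euclidean_space \<Rightarrow> 'a) \<Rightarrow> bool" where
  "smooth_unit_field v \<longleftrightarrow> smooth_tangent_field v \<and> (\<forall>x\<in>sphere 0 1. norm (v x) = 1)"

text \<open>Derivative of \<open>v\<close>, a map on the sphere, at \<open>x\<close> in a tangent direction \<open>X\<close>, computed from the
  extension of \<open>v\<close> that is constant along rays. Any other extension gives the same value, see
  \<open>sphere_deriv_extension\<close>.\<close>

definition sphere_deriv :: "('a::euclidean_space \<Rightarrow> 'b::real_normed_vector) \<Rightarrow> 'a \<Rightarrow> 'a \<Rightarrow> 'b" where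
  "sphere_deriv v x X = frechet_derivative (\<lambda>y. v (y /\<^sub>R norm y)) (at x) X"

text \<open>The Levi-Civita connection \<open>\<nabla>\<^sub>X v\<close> of the metric induced from the ambient space: the
  tangential part of the ambient derivative. That it is metric and torsion-free is shown in
  \<open>nabla_metric\<close> and \<open>nabla_torsion_free\<close>.\<close>

definition nabla :: "('a::euclidean_space \<Rightarrow> 'a) \<Rightarrow> 'a \<Rightarrow> 'a \<Rightarrow> 'a" where
  "nabla v x X = sphere_deriv v x X - (sphere_deriv v x X \<bullet> x) *\<^sub>R x"

text \<open>Riemannian measure of the unit sphere of an \<open>N\<close>-dimensional space: the measure of \<open>A\<close> is
  \<open>N\<close> times the Lebesgue measure of the cone \<open>{r x | x \<in> A, 0 < r < 1}\<close>.\<close>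

definition sphere_measure :: "'a::euclidean_space measure" where
  "sphere_measure = distr (scale_measure (of_nat DIM('a)) (restrict_space lborel (ball 0 1 - {0})))
     (restrict_space borel (sphere 0 1)) (\<lambda>x. x /\<^sub>R norm x)"


section \<open>The functionals \<open>\<B>\<^sub>k\<close> and Hopf vector fields\<close>

definition orthonormal_frame :: "'a::euclidean_space \<Rightarrow> (nat \<Rightarrow> 'a) \<Rightarrow> bool" where
  "orthonormal_frame x e \<longleftrightarrow> (\<forall>i<DIM('a) - 1. e i \<in> tangent_space x) \<and>
     (\<forall>i<DIM('a) - 1. \<forall>j<DIM('a) - 1. e i \<bullet> e j = (if i = j then 1 else 0))"

definition nabla_mat :: "('a::euclidean_space \<Rightarrow> 'a) \<Rightarrow> 'a \<Rightarrow> (nat \<Rightarrow> 'a) \<Rightarrow> real mat" where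
  "nabla_mat v x e = Matrix.mat (DIM('a) - 1) (DIM('a) - 1) (\<lambda>(A, B). nabla v x (e B) \<bullet> e A)"

text \<open>The sum of the squared \<open>k\<close>-minors does not depend on the orthonormal frame (it is the squared
  Hilbert-Schmidt norm of the \<open>k\<close>-th exterior power of \<open>\<nabla>v\<close>), so an arbitrary one is chosen at each
  point.\<close>

definition wedge_norm2 :: "nat \<Rightarrow> ('a::euclidean_space \<Rightarrow> 'a) \<Rightarrow> 'a \<Rightarrow> real" where
  "wedge_norm2 k v x = (let a = nabla_mat v x (SOME e. orthonormal_frame x e) in
     \<Sum>I | I \<subseteq> {..<DIM('a) - 1} \<and> card I = k. \<Sum>J | J \<subseteq> {..<DIM('a) - 1} \<and> card J = k.
       (Determinant.det (submatrix a I J))\<^sup>2)"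

definition B_functional :: "nat \<Rightarrow> ('a::euclidean_space \<Rightarrow> 'a) \<Rightarrow> real" where
  "B_functional k v = (\<integral>x. wedge_norm2 k v x \<partial>sphere_measure)"

definition orthogonal_complex_structure :: "('a::euclidean_space \<Rightarrow> 'a) \<Rightarrow> bool" where
  "orthogonal_complex_structure J \<longleftrightarrow> orthogonal_transformation J \<and> (\<forall>x. J (J x) = - x)"

definition hopf_field :: "('a::euclidean_space \<Rightarrow> 'a) \<Rightarrow> bool" where
  "hopf_field H \<longleftrightarrow> (\<exists>J. orthogonal_complex_structure J \<and> (\<forall>x\<in>sphere 0 1. H x = J x))"


section \<open>Adequacy of the definitions\<close>

lemma ex_orthonormal_frame:
  fixes x :: "'a::euclidean_space"
  assumes "x \<in> sphere 0 1"
  shows "\<exists>e. orthonormal_frame x e"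
proof -
  have x0: "x \<noteq> 0" using assms by auto
  have ts: "tangent_space x = {y. x \<bullet> y = 0}"
    by (auto simp: tangent_space_def inner_commute)
  have sub: "subspace (tangent_space x)"
    unfolding ts by (rule subspace_hyperplane)
  have dimt: "dim (tangent_space x) = DIM('a) - 1"
    unfolding ts by (rule dim_hyperplane[OF x0])
  obtain B where B: "B \<subseteq> tangent_space x" "pairwise real_inner_class.orthogonal B" "\<And>y. y \<in> B \<Longrightarrow> norm y = 1"
    "independent B" "card B = dim (tangent_space x)"
    using orthonormal_basis_subspace[OF sub] by metis
  have "finite B" using B(4) independent_imp_finite by blast
  then obtain e where e: "bij_betw e {0..<card B} B"
    using ex_bij_betw_nat_finite by blast
  have mem: "e i \<in> B" if "i < DIM('a) - 1" for i
    using e that B(5) dimt by (auto simp: bij_betw_def)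
  have "e i \<bullet> e j = (if i = j then 1 else 0)" if "i < DIM('a) - 1" "j < DIM('a) - 1" for i j
  proof (cases "i = j")
    case True
    then show ?thesis using B(3)[OF mem[OF that(1)]] by (simp add: norm_eq_1)
  next
    case False
    have "e i \<noteq> e j"
      using e that B(5) dimt False by (auto simp: bij_betw_def inj_on_def)
    then show ?thesis
      using B(2) mem[OF that(1)] mem[OF that(2)] False by (auto simp: pairwise_def real_inner_class.orthogonal_def)
  qed
  then have "orthonormal_frame x e"
    using mem B(1) by (auto simp: orthonormal_frame_def)
  then show ?thesis by blast
qed

lemma smooth_on_imp_differentiable:
  assumes "smooth_on U f" "x \<in> U"
  shows "f differentiable (at x)"
proof -
  have "Ck_on (Suc 0) U f" using assms(1) by (auto simp only: smooth_on_def)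
  then show ?thesis using assms(2) by simp
qed

lemma normalize_has_derivative:
  fixes x :: "'a::euclidean_space"
  assumes "x \<in> sphere 0 1"
  shows "((\<lambda>y. y /\<^sub>R norm y) has_derivative (\<lambda>h. h - (h \<bullet> x) *\<^sub>R x)) (at x)"
proof -
  have "norm x = 1" "x \<noteq> 0" using assms by auto
  then have "((\<lambda>y. y /\<^sub>R norm y) has_derivative
      (\<lambda>h. inverse (norm x) *\<^sub>R h + (- (inverse (norm x) * (h \<bullet> sgn x) * inverse (norm x))) *\<^sub>R x)) (at x)"
    by (auto intro!: derivative_eq_intros has_derivative_norm)
  then show ?thesis
    using \<open>norm x = 1\<close> by (simp add: sgn_div_norm)
qed

lemma extension_has_derivative:
  fixes v :: "'a::euclidean_space \<Rightarrow> 'b::real_normed_vector"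
  assumes "x \<in> sphere 0 1" "open U" "x \<in> U" "\<forall>y\<in>U \<inter> sphere 0 1. g y = v y"
    and g: "(g has_derivative g') (at x)"
  shows "((\<lambda>y. v (y /\<^sub>R norm y)) has_derivative (\<lambda>h. g' (h - (h \<bullet> x) *\<^sub>R x))) (at x)"
proof -
  define r where "r = (\<lambda>y::'a. y /\<^sub>R norm y)"
  have rx: "r x = x" using assms(1) by (simp add: r_def)
  have r: "(r has_derivative (\<lambda>h. h - (h \<bullet> x) *\<^sub>R x)) (at x)"
    unfolding r_def by (rule normalize_has_derivative[OF assms(1)])
  have comp: "((\<lambda>y. g (r y)) has_derivative (\<lambda>h. g' (h - (h \<bullet> x) *\<^sub>R x))) (at x)"
    using has_derivative_compose[OF r, of g g'] g rx by simp
  have "isCont r x" using r has_derivative_continuous by blast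
  then have "(r \<longlongrightarrow> x) (at x)" using rx by (simp add: isCont_def)
  then have "\<forall>\<^sub>F y in at x. r y \<in> U"
    using assms(2,3) topological_tendstoD by blast
  moreover have "\<forall>\<^sub>F y in at x. y \<noteq> 0"
    using assms(1) by (intro eventually_neq_at_within)
  ultimately have "\<forall>\<^sub>F y in at x. g (r y) = v (r y)"
    by eventually_elim (use assms(4) in \<open>auto simp: r_def\<close>)
  moreover have "g (r x) = v (r x)"
    using assms(1,3,4) rx by simp
  ultimately have "((\<lambda>y. v (r y)) has_derivative (\<lambda>h. g' (h - (h \<bullet> x) *\<^sub>R x))) (at x)"
    using has_derivative_transform_eventually[OF comp] by simp
  then show ?thesis by (simp add: r_def)
qed

lemma sphere_deriv_extension:
  fixes v :: "'a::euclidean_space \<Rightarrow> 'b::real_normed_vector"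
  assumes "x \<in> sphere 0 1" "open U" "x \<in> U" "\<forall>y\<in>U \<inter> sphere 0 1. g y = v y"
    and "(g has_derivative g') (at x)" "X \<in> tangent_space x"
  shows "sphere_deriv v x X = g' X"
  using frechet_derivative_at[OF extension_has_derivative[OF assms(1-5)]] assms(6)
  by (auto simp: sphere_deriv_def tangent_space_def fun_eq_iff dest: spec[of _ X])

lemma sphere_deriv_works:
  assumes "smooth_on_sphere v" "x \<in> sphere 0 1"
  shows "((\<lambda>y. v (y /\<^sub>R norm y)) has_derivative sphere_deriv v x) (at x)"
proof -
  obtain U g where U: "open U" "x \<in> U" "smooth_on U g" "\<forall>y\<in>U \<inter> sphere 0 1. g y = v y"
    using assms unfolding smooth_on_sphere_def by blast
  have "(g has_derivative frechet_derivative g (at x)) (at x)"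
    using smooth_on_imp_differentiable[OF U(3,2)] frechet_derivative_works by blast
  from extension_has_derivative[OF assms(2) U(1,2,4) this] show ?thesis
    unfolding sphere_deriv_def using frechet_derivative_at by (metis (no_types, lifting) eta_contract_eq)
qed

lemma nabla_metric:
  fixes v w :: "'a::euclidean_space \<Rightarrow> 'a"
  assumes "smooth_tangent_field v" "smooth_tangent_field w" "x \<in> sphere 0 1"
  shows "sphere_deriv (\<lambda>y. v y \<bullet> w y) x X = nabla v x X \<bullet> w x + v x \<bullet> nabla w x X"
proof -
  have [simp]: "norm x = 1" using assms(3) by simp
  have D: "((\<lambda>y. v (y /\<^sub>R norm y)) has_derivative sphere_deriv v x) (at x)"
          "((\<lambda>y. w (y /\<^sub>R norm y)) has_derivative sphere_deriv w x) (at x)"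
    using assms unfolding smooth_tangent_field_def by (blast intro: sphere_deriv_works)+
  have "sphere_deriv (\<lambda>y. v y \<bullet> w y) x = (\<lambda>h. v x \<bullet> sphere_deriv w x h + sphere_deriv v x h \<bullet> w x)"
    unfolding sphere_deriv_def[of "\<lambda>y. v y \<bullet> w y"]
    using frechet_derivative_at[OF has_derivative_inner[OF D]] by simp
  moreover have "v x \<bullet> x = 0" "w x \<bullet> x = 0"
    using assms by (auto simp: smooth_tangent_field_def tangent_space_def)
  ultimately show ?thesis
    by (simp add: nabla_def inner_diff_left inner_diff_right inner_commute[of x])
qed

lemma sphere_deriv_normal_part:
  fixes v :: "'a::euclidean_space \<Rightarrow> 'a"
  assumes "smooth_tangent_field v" "x \<in> sphere 0 1" "X \<in> tangent_space x"
  shows "sphere_deriv v x X \<bullet> x = - (v x \<bullet> X)"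
proof -
  have nx [simp]: "norm x = 1" using assms(2) by simp
  have "((\<lambda>y. v (y /\<^sub>R norm y) \<bullet> (y /\<^sub>R norm y)) has_derivative
      (\<lambda>h. v (x /\<^sub>R norm x) \<bullet> (h - (h \<bullet> x) *\<^sub>R x) + sphere_deriv v x h \<bullet> (x /\<^sub>R norm x))) (at x)"
    using assms by (intro has_derivative_inner sphere_deriv_works normalize_has_derivative)
      (auto simp: smooth_tangent_field_def)
  moreover have "((\<lambda>y. v (y /\<^sub>R norm y) \<bullet> (y /\<^sub>R norm y)) has_derivative (\<lambda>h. 0)) (at x)"
  proof (rule has_derivative_transform_eventually[of "\<lambda>_. 0"])
    have z: "0 = v (y /\<^sub>R norm y) \<bullet> (y /\<^sub>R norm y)" for y
    proof (cases "y = 0")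
      case False
      then have "y /\<^sub>R norm y \<in> sphere 0 1" by simp
      then have "v (y /\<^sub>R norm y) \<in> tangent_space (y /\<^sub>R norm y)"
        using assms(1) unfolding smooth_tangent_field_def by blast
      then show ?thesis unfolding tangent_space_def by simp
    qed simp
    show "\<forall>\<^sub>F y in at x. 0 = v (y /\<^sub>R norm y) \<bullet> (y /\<^sub>R norm y)"
      using z by (rule always_eventually[OF allI])
    show "0 = v (x /\<^sub>R norm x) \<bullet> (x /\<^sub>R norm x)" by (rule z)
  qed auto
  ultimately have "(\<lambda>h. v (x /\<^sub>R norm x) \<bullet> (h - (h \<bullet> x) *\<^sub>R x) + sphere_deriv v x h \<bullet> (x /\<^sub>R norm x)) = (\<lambda>h. 0)"
    by (rule has_derivative_unique)
  from fun_cong[OF this, of X] show ?thesis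
    using assms(3) by (simp add: tangent_space_def)
qed

text \<open>The right-hand side is the Lie bracket of \<open>v\<close> and \<open>w\<close>.\<close>

lemma nabla_torsion_free:
  fixes v w :: "'a::euclidean_space \<Rightarrow> 'a"
  assumes "smooth_tangent_field v" "smooth_tangent_field w" "x \<in> sphere 0 1"
  shows "nabla w x (v x) - nabla v x (w x) = sphere_deriv w x (v x) - sphere_deriv v x (w x)"
proof -
  have "v x \<in> tangent_space x" "w x \<in> tangent_space x"
    using assms by (auto simp: smooth_tangent_field_def)
  then show ?thesis
    using sphere_deriv_normal_part[OF assms(1,3)] sphere_deriv_normal_part[OF assms(2,3)]
    by (simp add: nabla_def inner_commute)
qed

lemma measurable_normalize:
  "(\<lambda>x::'a::euclidean_space. x /\<^sub>R norm x) \<in>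
     restrict_space lborel (ball 0 1 - {0}) \<rightarrow>\<^sub>M restrict_space borel (sphere 0 1)"
  by (rule measurable_restrict_space2)
     (auto simp: space_restrict_space intro!: measurable_restrict_space1)

lemma emeasure_sphere_measure:
  fixes A :: "'a::euclidean_space set"
  assumes "A \<in> sets borel" "A \<subseteq> sphere 0 1"
  shows "emeasure sphere_measure A =
    of_nat DIM('a) * emeasure lborel {x \<in> ball 0 1 - {0}. x /\<^sub>R norm x \<in> A}"
proof -
  have A: "A \<in> sets (restrict_space borel (sphere 0 1))"
    using assms by (subst sets_restrict_space_iff) auto
  let ?L = "restrict_space lborel (ball 0 1 - {0}) :: 'a measure"
  let ?S = "scale_measure (of_nat DIM('a)) ?L"
  have m: "(\<lambda>x. x /\<^sub>R norm x) \<in> ?S \<rightarrow>\<^sub>M restrict_space borel (sphere 0 1)"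
    using measurable_normalize measurable_cong_sets[OF sets_scale_measure refl] by blast
  have eq: "(\<lambda>x. x /\<^sub>R norm x) -` A \<inter> space ?S = {x \<in> ball 0 1 - {0}. x /\<^sub>R norm x \<in> A}"
    by (auto simp: space_scale_measure space_restrict_space)
  have "emeasure sphere_measure A = emeasure ?S {x \<in> ball 0 1 - {0}. x /\<^sub>R norm x \<in> A}"
    unfolding sphere_measure_def by (simp only: emeasure_distr[OF m A] eq)
  also have "\<dots> = of_nat DIM('a) * emeasure ?L {x \<in> ball 0 1 - {0}. x /\<^sub>R norm x \<in> A}"
    by (rule emeasure_scale_measure)
  also have "emeasure ?L {x \<in> ball 0 1 - {0}. x /\<^sub>R norm x \<in> A} =
      emeasure lborel {x \<in> ball 0 1 - {0}. x /\<^sub>R norm x \<in> A}"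
    by (rule emeasure_restrict_space) auto
  finally show ?thesis .
qed

lemma emeasure_sphere_measure_total:
  "emeasure (sphere_measure :: 'a measure) (sphere 0 1) =
     of_nat DIM('a) * ennreal (unit_ball_vol (DIM('a::euclidean_space)))"
proof -
  have "{x \<in> ball 0 1 - {0}. x /\<^sub>R norm x \<in> sphere 0 1} = ball (0::'a) 1 - {0}"
    by auto
  moreover have "emeasure lborel (ball (0::'a) 1 - {0}) = emeasure lborel (ball (0::'a) 1)"
    by (intro emeasure_Diff_null_set) auto
  ultimately show ?thesis
    by (subst emeasure_sphere_measure) (auto simp: emeasure_ball)
qed

lemma Ck_on_const: "Ck_on k U (\<lambda>x. c)"
  by (induction k arbitrary: c) (auto simp: frechet_derivative_const)

lemma smooth_on_linear:
  fixes f :: "'a::euclidean_space \<Rightarrow> 'b::real_normed_vector"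
  assumes "linear f"
  shows "smooth_on U f"
proof -
  have bl: "bounded_linear f" using assms linear_conv_bounded_linear by blast
  have fd: "frechet_derivative f (at x) = f" for x
    using frechet_derivative_at[OF bounded_linear_imp_has_derivative[OF bl]] by simp
  have "Ck_on k U f" for k
    by (cases k)
       (auto simp: fd Ck_on_const bounded_linear_imp_differentiable[OF bl]
          linear_continuous_on[OF bl])
  then show ?thesis by (simp add: smooth_on_def)
qed

lemma hopf_field_smooth_unit_field:
  assumes "hopf_field H"
  shows "smooth_unit_field H"
proof -
  obtain J where J: "orthogonal_transformation J" "\<And>x. J (J x) = - x"
      "\<And>x. x \<in> sphere 0 1 \<Longrightarrow> H x = J x"
    using assms by (auto simp: hopf_field_def orthogonal_complex_structure_def)
  have "linear J" using J(1) by (simp add: orthogonal_transformation_def)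
  then have "smooth_on UNIV J" by (rule smooth_on_linear)
  then have "smooth_on_sphere H"
    unfolding smooth_on_sphere_def using J(3) by (metis IntD2 UNIV_I open_UNIV)
  moreover have "J x \<bullet> x = 0" for x
  proof -
    have "J x \<bullet> x = J (J x) \<bullet> J x"
      using J(1) by (simp add: orthogonal_transformation_def)
    then show ?thesis using J(2) by (simp add: inner_commute)
  qed
  moreover have "norm (J x) = norm x" for x
    using J(1) by (rule orthogonal_transformation_norm)
  ultimately show ?thesis
    using J(3) by (simp add: smooth_unit_field_def smooth_tangent_field_def tangent_space_def)
qed

end

theory Submission
  imports Defs
begin

no_notation Matrix.vec_index (infixl "$" 100)

text \<open>Let \<open>w y = |y| v(y/|y|)\<close> be the 1-homogeneous extension of \<open>v\<close>. For large \<open>s\<close> the map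
  \<open>y \<mapsto> s y + w y\<close> is a bijection of the unit ball onto the ball of radius \<open>sqrt (s\<^sup>2 + 1)\<close>, since \<open>w\<close> is
  Lipschitz and \<open>w y\<close> is orthogonal to \<open>y\<close> and of the same length. By change of variables
  \<open>\<integral> det (s + Dw) = (s\<^sup>2 + 1)\<^bsup>n+1\<^esup> vol\<close>; both sides are polynomials in \<open>s\<close>, so \<open>\<integral> det Dw = vol\<close> at \<open>s = 0\<close>.

  Pointwise, the sum of the squared \<open>n\<close>-minors is at least \<open>(2n choose n) |det Dw|\<close>. By Cauchy--Binet it
  does not depend on the orthonormal bases used for rows and for columns, and these can be chosen such
  that \<open>Dw\<close> and \<open>\<nabla>v\<close> are upper triangular with the same \<open>2n\<close> relevant diagonal entries \<open>r\<^sub>i\<close>; keeping only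
  the principal minors and pairing each \<open>I\<close> with its complement leaves
  \<open>(\<Prod>\<^sub>I r\<^sub>i)\<^sup>2 + (\<Prod>\<^sub>I\<^sub>c r\<^sub>i)\<^sup>2 \<ge> 2 \<Prod> |r\<^sub>i|\<close>. For a Hopf field \<open>\<nabla>H\<close> is an isometry of a \<open>2n\<close>-plane and
  equality holds at every point.\<close>

section \<open>Sums of squared minors\<close>

lemma bij_betw_pick:
  assumes "finite I"
  shows "bij_betw (pick I) {0..<card I} I"
proof -
  have "inj_on (pick I) {0..<card I}"
    by (rule inj_onI) (metis atLeastLessThan_iff linorder_neqE_nat order_less_irrefl pick_mono_le)
  moreover have "pick I ` {0..<card I} \<subseteq> I"
    using pick_in_set_le by auto
  ultimately show ?thesis
    unfolding bij_betw_def using assms by (metis card_atLeastLessThan card_image card_subset_eq diff_zero)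
qed

section \<open>Determinants given by entry functions and the Cauchy-Binet formula\<close>

lemma det_mat_permute_rows:
  fixes c :: "nat \<Rightarrow> nat \<Rightarrow> real"
  assumes "p permutes {0..<k}"
  shows "Determinant.det (Matrix.mat k k (\<lambda>(i,j). c (p i) j)) = signof p * Determinant.det (Matrix.mat k k (\<lambda>(i,j). c i j))"
proof -
  have "Determinant.det (Matrix.mat k k (\<lambda> (i,j). (Matrix.mat k k (\<lambda>(i,j). c i j)) $$ (p i, j))) = signof p * Determinant.det (Matrix.mat k k (\<lambda>(i,j). c i j))"
    by (rule det_permute_rows) (use assms in auto)
  moreover have "Matrix.mat k k (\<lambda> (i,j). (Matrix.mat k k (\<lambda>(i,j). c i j)) $$ (p i, j)) = Matrix.mat k k (\<lambda>(i,j). c (p i) j)"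
    using permutes_in_image[OF assms] by (intro eq_matI) auto
  ultimately show ?thesis by simp
qed

lemma det_mat_leibniz:
  fixes c :: "nat \<Rightarrow> nat \<Rightarrow> real"
  shows "Determinant.det (Matrix.mat k k (\<lambda>(i,j). c i j)) = (\<Sum>p | p permutes {0..<k}. signof p * (\<Prod>i=0..<k. c i (p i)))"
proof -
  have "(\<Prod>i=0..<k. Matrix.mat k k (\<lambda>(i,j). c i j) $$ (i, p i)) = (\<Prod>i=0..<k. c i (p i))"
    if "p permutes {0..<k}" for p
    using permutes_in_image[OF that] by (intro prod.cong) auto
  then show ?thesis
    by (subst det_def'[of _ k]) auto
qed

lemma det_mat_zero_row:
  fixes c :: "nat \<Rightarrow> nat \<Rightarrow> real"
  assumes "i < k" "\<And>j. j < k \<Longrightarrow> c i j = 0"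
  shows "Determinant.det (Matrix.mat k k (\<lambda>(i,j). c i j)) = 0"
proof -
  have "(\<Prod>i=0..<k. c i (p i)) = 0" if "p permutes {0..<k}" for p
    using assms permutes_in_image[OF that, of i] by (intro prod_zero bexI[of _ i]) auto
  then show ?thesis
    unfolding det_mat_leibniz by (intro sum.neutral) auto
qed

lemma det_mat_transpose:
  fixes c :: "nat \<Rightarrow> nat \<Rightarrow> real"
  shows "Determinant.det (Matrix.mat k k (\<lambda>(i,j). c j i)) = Determinant.det (Matrix.mat k k (\<lambda>(i,j). c i j))"
proof -
  have "Matrix.mat k k (\<lambda>(i,j). c j i) = Matrix.transpose_mat (Matrix.mat k k (\<lambda>(i,j). c i j))"
    by (intro eq_matI) auto
  then show ?thesis using det_transpose[of "Matrix.mat k k (\<lambda>(i,j). c i j)" k] by simp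
qed

lemma det_mat_zero_col:
  fixes c :: "nat \<Rightarrow> nat \<Rightarrow> real"
  assumes "j < k" "\<And>i. i < k \<Longrightarrow> c i j = 0"
  shows "Determinant.det (Matrix.mat k k (\<lambda>(i,j). c i j)) = 0"
  using det_mat_zero_row[of j k "\<lambda>i j. c j i"] assms det_mat_transpose[of k c] by auto

lemma det_mat_repeated_rows:
  fixes c :: "nat \<Rightarrow> nat \<Rightarrow> real"
  assumes "\<not> inj_on f {0..<k}"
  shows "Determinant.det (Matrix.mat k k (\<lambda>(i,j). c (f i) j)) = 0"
proof -
  obtain i j where ij: "i < k" "j < k" "i \<noteq> j" "f i = f j"
    using assms by (auto simp: inj_on_def)
  show ?thesis
    by (rule det_identical_rows[OF _ ij(3,1,2)]) (use ij in \<open>auto intro!: eq_vecI\<close>)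
qed

text \<open>Cauchy-Binet for a matrix and its transpose. Multilinear expansion of the Leibniz
  formula gives one term for each choice \<open>f\<close> of a row index per position. Choices with
  a repetition vanish, since \<open>D f\<close> then has equal rows. The injective ones are grouped
  by their image \<open>I\<close>, and each group rebuilds the minor on \<open>I\<close> as a second
  factor.\<close>

lemma det_gram_eq_sum_minors:
  fixes c :: "nat \<Rightarrow> nat \<Rightarrow> real"
  shows "Determinant.det (Matrix.mat k k (\<lambda>(p,q). \<Sum>i<m. c i p * c i q)) =
    (\<Sum>I | I \<subseteq> {..<m} \<and> card I = k. (Determinant.det (Matrix.mat k k (\<lambda>(p,q). c (pick I p) q)))\<^sup>2)"
proof -
  let ?F = "{0..<k} \<rightarrow>\<^sub>E {..<m}"
  let ?S = "{f \<in> ?F. inj_on f {0..<k}}"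
  let ?T = "{I. I \<subseteq> {..<m} \<and> card I = k}"
  define D where "D = (\<lambda>f. Determinant.det (Matrix.mat k k (\<lambda>(p,q). c (f p) q)))"
  define h where "h = (\<lambda>f. (\<Prod>p=0..<k. c (f p) p) * D f)"
  have finF: "finite ?F" by (intro finite_PiE) auto
  have "Determinant.det (Matrix.mat k k (\<lambda>(p,q). \<Sum>i<m. c i p * c i q)) =
     (\<Sum>s | s permutes {0..<k}. signof s * (\<Prod>p=0..<k. \<Sum>i<m. c i p * c i (s p)))"
    by (rule det_mat_leibniz)
  also have "\<dots> = (\<Sum>s | s permutes {0..<k}. \<Sum>f\<in>?F. (\<Prod>p=0..<k. c (f p) p) * (signof s * (\<Prod>p=0..<k. c (f p) (s p))))"
    by (intro sum.cong refl) (simp add: prod_sum_PiE prod.distrib sum_distrib_left mult_ac)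
  also have "\<dots> = (\<Sum>f\<in>?F. h f)"
    unfolding h_def D_def by (subst sum.swap) (simp add: det_mat_leibniz sum_distrib_left)
  also have "\<dots> = (\<Sum>f\<in>?S. h f)"
    using finF by (intro sum.mono_neutral_right) (auto simp: h_def D_def det_mat_repeated_rows)
  also have "\<dots> = (\<Sum>I\<in>?T. \<Sum>f\<in>{f\<in>?S. f ` {0..<k} = I}. h f)"
    using finF by (intro sum.group[symmetric]) (auto simp: card_image)
  also have "\<dots> = (\<Sum>I\<in>?T. (D (pick I))\<^sup>2)"
  proof (intro sum.cong refl)
    fix I assume I: "I \<in> ?T"
    then have finI: "finite I" and cI: "card I = k" using finite_subset by auto
    have bij: "bij_betw (pick I) {0..<k} I" using bij_betw_pick[OF finI] cI by simp
    define r where "r = inv_into {0..<k} (pick I)"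
    have rI: "r i < k" "pick I (r i) = i" if "i \<in> I" for i
      using bij_betw_inv_into_right[OF bij that] bij_betwE[OF bij_betw_inv_into[OF bij]] that by (auto simp: r_def)
    have rp: "r (pick I p) = p" if "p < k" for p
      using bij_betw_inv_into_left[OF bij] that by (simp add: r_def)
    have pI: "pick I p \<in> I" if "p < k" for p using bij_betwE[OF bij] that by auto
    have sub: "i < m" if "i \<in> I" for i using I that by auto
    \<comment> \<open>An injective \<open>f\<close> with image \<open>I\<close> is
      \<open>pick I\<close> after a unique permutation, recovered through the rank function
      \<open>r\<close>. Permutations are the identity outside \<open>{0..<k}\<close> and members of
      \<open>?F\<close> are undefined there, which explains the two extensions in the
      witnesses.\<close>
    have "(\<Sum>f\<in>{f\<in>?S. f ` {0..<k} = I}. h f) = (\<Sum>s | s permutes {0..<k}. (\<Prod>p=0..<k. c (pick I (s p)) p) * (signof s * D (pick I)))"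
    proof (rule sum.reindex_bij_witness[where i = "\<lambda>s. restrict (pick I \<circ> s) {0..<k}"
          and j = "\<lambda>f p. if p < k then r (f p) else p"])
      fix f assume f: "f \<in> {f\<in>?S. f ` {0..<k} = I}"
      let ?s = "\<lambda>p. if p < k then r (f p) else p"
      have fI: "f p \<in> I" if "p < k" for p using f that by auto
      show fs: "restrict (pick I \<circ> ?s) {0..<k} = f"
        using f fI rI by (auto simp: fun_eq_iff PiE_def extensional_def)
      have "inj_on (\<lambda>p. r (f p)) {0..<k}"
      proof (rule inj_onI)
        fix p q assume pq: "p \<in> {0..<k}" "q \<in> {0..<k}" "r (f p) = r (f q)"
        then have "f p = f q" using rI(2) fI by (metis atLeastLessThan_iff)
        then show "p = q" using f pq by (auto dest: inj_onD)
      qed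
      then have "inj_on ?s {0..<k}" by (auto simp: inj_on_def)
      moreover have "?s ` {0..<k} \<subseteq> {0..<k}" using rI fI by auto
      ultimately have "bij_betw ?s {0..<k} {0..<k}"
        unfolding bij_betw_def using endo_inj_surj[of "{0..<k}" ?s] by blast
      then show s: "?s \<in> {s. s permutes {0..<k}}"
        by (auto intro!: bij_imp_permutes)
      have "D f = signof ?s * D (pick I)"
      proof -
        have "Matrix.mat k k (\<lambda>(p,q). c (f p) q) = Matrix.mat k k (\<lambda>(p,q). c (pick I (?s p)) q)"
          using fI rI(2) by (intro cong_mat) auto
        then show ?thesis
          unfolding D_def using det_mat_permute_rows[of ?s k "\<lambda>p. c (pick I p)"] s by simp
      qed
      moreover have "(\<Prod>p=0..<k. c (pick I (?s p)) p) = (\<Prod>p=0..<k. c (f p) p)"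
        using fI rI by (intro prod.cong) auto
      ultimately show "(\<Prod>p=0..<k. c (pick I (?s p)) p) * (signof ?s * D (pick I)) = h f"
        by (simp add: h_def)
    next
      fix s assume s: "s \<in> {s. s permutes {0..<k}}"
      then have s': "s permutes {0..<k}" by simp
      have sk: "s p < k" if "p < k" for p using permutes_in_image[OF s', of p] that by simp
      show "(\<lambda>p. if p < k then r (restrict (pick I \<circ> s) {0..<k} p) else p) = s"
        using sk rp permutes_not_in[OF s'] by (auto simp: fun_eq_iff)
      have im: "(pick I \<circ> s) ` {0..<k} = I"
        using permutes_image[OF s'] bij by (simp only: image_comp[symmetric] bij_betw_def)
      moreover have "inj_on (pick I \<circ> s) {0..<k}"
        using bij permutes_image[OF s'] permutes_inj_on[OF s'] by (auto simp: bij_betw_def intro: comp_inj_on)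
      ultimately show "restrict (pick I \<circ> s) {0..<k} \<in> {f\<in>?S. f ` {0..<k} = I}"
        using sub pI sk by auto
    qed
    also have "\<dots> = D (pick I) * (\<Sum>s | s permutes {0..<k}. signof s * (\<Prod>p=0..<k. c (pick I (s p)) p))"
      by (simp add: sum_distrib_left mult_ac)
    also have "(\<Sum>s | s permutes {0..<k}. signof s * (\<Prod>p=0..<k. c (pick I (s p)) p)) = D (pick I)"
      unfolding D_def det_mat_leibniz[of k "\<lambda>p q. c (pick I q) p", symmetric]
      by (rule det_mat_transpose)
    finally show "(\<Sum>f\<in>{f\<in>?S. f ` {0..<k} = I}. h f) = (D (pick I))\<^sup>2"
      by (simp add: power2_eq_square)
  qed
  finally show ?thesis unfolding D_def .
qed

section \<open>Sums of squared minors and zero borders\<close>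

text \<open>This is the squared Hilbert-Schmidt norm of the \<open>k\<close>-th exterior power of
  the operator with matrix \<open>a\<close>. The entries form a function, so that the same
  \<open>a\<close> can be read at size \<open>DIM('a) - 1\<close> and at size
  \<open>DIM('a)\<close>.\<close>

definition minor_sum :: "nat \<Rightarrow> nat \<Rightarrow> (nat \<Rightarrow> nat \<Rightarrow> real) \<Rightarrow> real" where
  "minor_sum k N a = (\<Sum>I | I \<subseteq> {..<N} \<and> card I = k. \<Sum>J | J \<subseteq> {..<N} \<and> card J = k.
     (Determinant.det (Matrix.mat k k (\<lambda>(p,q). a (pick I p) (pick J q))))\<^sup>2)"

lemma submatrix_mat:
  fixes a :: "nat \<Rightarrow> nat \<Rightarrow> real"
  assumes "I \<subseteq> {..<N}" "card I = k" "J \<subseteq> {..<N}" "card J = k"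
  shows "submatrix (Matrix.mat N N (\<lambda>(i,j). a i j)) I J = Matrix.mat k k (\<lambda>(p,q). a (pick I p) (pick J q))"
proof -
  have "{i. i < N \<and> i \<in> I} = I" "{i. i < N \<and> i \<in> J} = J" using assms by auto
  moreover have "pick I p < N" "pick J p < N" if "p < k" for p
    using pick_in_set_le[of p I] pick_in_set_le[of p J] that assms by auto
  ultimately show ?thesis
    unfolding submatrix_def using assms by (intro eq_matI) auto
qed

lemma minor_sum_cong:
  assumes "\<And>i j. i < N \<Longrightarrow> j < N \<Longrightarrow> a i j = b i j"
  shows "minor_sum k N a = minor_sum k N b"
proof -
  have "Matrix.mat k k (\<lambda>(p,q). a (pick I p) (pick J q)) = Matrix.mat k k (\<lambda>(p,q). b (pick I p) (pick J q))"
    if "I \<subseteq> {..<N}" "card I = k" "J \<subseteq> {..<N}" "card J = k" for I J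
    using that assms pick_in_set_le[of _ I] pick_in_set_le[of _ J] by (intro cong_mat) (auto simp: subset_iff)
  then show ?thesis
    unfolding minor_sum_def by (intro sum.cong refl) auto
qed

lemma minor_sum_transpose: "minor_sum k N (\<lambda>i j. a j i) = minor_sum k N a"
proof -
  have "Determinant.det (Matrix.mat k k (\<lambda>(p,q). a (pick J q) (pick I p))) =
     Determinant.det (Matrix.mat k k (\<lambda>(p,q). a (pick J p) (pick I q)))" for I J
    by (rule det_mat_transpose[of k "\<lambda>p q. a (pick J p) (pick I q)"])
  then show ?thesis
    unfolding minor_sum_def by (subst sum.swap) simp
qed

lemma pick_surj:
  assumes "i \<in> I" "finite I"
  obtains p where "p < card I" "pick I p = i"
proof -
  have "i \<in> pick I ` {0..<card I}" using bij_betw_pick[OF assms(2)] assms(1) by (simp add: bij_betw_def)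
  then show ?thesis using that by auto
qed

text \<open>A minor whose row or column set contains \<open>N\<close> has a zero row or a zero
  column. This allows passing from the tangent space to the ambient space by adjoining the radial
  direction.\<close>

lemma minor_sum_zero_border:
  assumes "\<And>i. i \<le> N \<Longrightarrow> a i N = 0" "\<And>j. j \<le> N \<Longrightarrow> a N j = 0"
  shows "minor_sum k (Suc N) a = minor_sum k N a"
proof -
  let ?S = "{I. I \<subseteq> {..<Suc N} \<and> card I = k}" and ?T = "{I. I \<subseteq> {..<N} \<and> card I = k}"
  let ?d = "\<lambda>I J. Determinant.det (Matrix.mat k k (\<lambda>(p,q). a (pick I p) (pick J q)))"
  have fin: "finite ?S" by simp
  have ST: "?T \<subseteq> ?S" by auto
  have N: "N \<in> I" if "I \<in> ?S - ?T" for I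
    using that by (auto simp: lessThan_Suc)
  have le: "pick I p \<le> N" if "I \<in> ?S" "p < k" for I p
    using that pick_in_set_le[of p I] by (auto simp: less_Suc_eq_le subset_iff)
  have row: "?d I J = 0" if I: "I \<in> ?S - ?T" and J: "J \<in> ?S" for I J
  proof -
    obtain p where "p < k" "pick I p = N"
      using pick_surj[OF N[OF I]] I finite_subset[OF _ finite_lessThan] by (metis (mono_tags, lifting) DiffD1 mem_Collect_eq)
    then show ?thesis using assms(2) le[OF J] by (intro det_mat_zero_row) auto
  qed
  have col: "?d I J = 0" if J: "J \<in> ?S - ?T" and I: "I \<in> ?S" for I J
  proof -
    obtain p where "p < k" "pick J p = N"
      using pick_surj[OF N[OF J]] J finite_subset[OF _ finite_lessThan] by (metis (mono_tags, lifting) DiffD1 mem_Collect_eq)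
    then show ?thesis using assms(1) le[OF I] by (intro det_mat_zero_col) auto
  qed
  have "minor_sum k (Suc N) a = (\<Sum>I\<in>?S. \<Sum>J\<in>?T. (?d I J)\<^sup>2)"
    unfolding minor_sum_def using fin ST col by (intro sum.cong[OF refl] sum.mono_neutral_right) auto
  also have "\<dots> = (\<Sum>I\<in>?T. \<Sum>J\<in>?T. (?d I J)\<^sup>2)"
  proof (rule sum.mono_neutral_right[OF fin ST])
    show "\<forall>I\<in>?S - ?T. (\<Sum>J\<in>?T. (?d I J)\<^sup>2) = 0"
      using row ST by (intro ballI sum.neutral) (metis (no_types, lifting) power_zero_numeral subset_iff)
  qed
  finally show ?thesis by (simp add: minor_sum_def)
qed

section \<open>Orthonormal bases and invariance of the minor sums\<close>

definition onb :: "(nat \<Rightarrow> 'a::euclidean_space) \<Rightarrow> bool" where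
  "onb e \<longleftrightarrow> (\<forall>i<DIM('a). \<forall>j<DIM('a). e i \<bullet> e j = (if i = j then 1 else 0))"

lemma onb_inner:
  fixes e :: "nat \<Rightarrow> 'a::euclidean_space"
  assumes "onb e"
  shows "(\<Sum>i<DIM('a). (x \<bullet> e i) * (y \<bullet> e i)) = x \<bullet> y"
proof -
  let ?B = "e ` {..<DIM('a)}"
  have inj: "inj_on e {..<DIM('a)}"
  proof (rule inj_onI)
    fix i j assume "i \<in> {..<DIM('a)}" "j \<in> {..<DIM('a)}" "e i = e j"
    with assms show "i = j" unfolding onb_def by (metis lessThan_iff zero_neq_one)
  qed
  have orth: "pairwise real_inner_class.orthogonal ?B"
    using assms by (auto simp: pairwise_def real_inner_class.orthogonal_def onb_def)
  have nrm: "norm b = 1" if "b \<in> ?B" for b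
    using assms that by (auto simp: onb_def norm_eq_1)
  then have "0 \<notin> ?B" by fastforce
  then have "independent ?B" using orth by (rule pairwise_orthogonal_independent[rotated])
  moreover have "card ?B = DIM('a)" using inj by (simp add: card_image)
  ultimately have "span ?B = UNIV"
    by (metis card_eq_dim dim_UNIV finite_imageI finite_lessThan order_refl subset_UNIV top.extremum_uniqueI)
  then have "(\<Sum>b\<in>?B. (x \<bullet> b) *\<^sub>R b) = x"
    using orthonormal_basis_expand[OF orth nrm] by simp
  then have "x = (\<Sum>i<DIM('a). (x \<bullet> e i) *\<^sub>R e i)"
    using inj by (simp add: sum.reindex)
  then have "x \<bullet> y = (\<Sum>i<DIM('a). (x \<bullet> e i) *\<^sub>R e i) \<bullet> y" by simp
  then show ?thesis by (simp add: inner_sum_left inner_commute[of y])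
qed

text \<open>For a fixed column set \<open>J\<close>, Cauchy-Binet turns the sum over the row sets
  into the Gram determinant of the vectors \<open>u j\<close> with \<open>j\<close> in
  \<open>J\<close>; by Parseval (\<open>onb_inner\<close>) this does not see the basis.\<close>

lemma minor_sum_row_basis:
  fixes f g :: "nat \<Rightarrow> 'a::euclidean_space"
  assumes "onb f" "onb g"
  shows "minor_sum k DIM('a) (\<lambda>i j. u j \<bullet> f i) = minor_sum k DIM('a) (\<lambda>i j. u j \<bullet> g i)"
proof -
  have "minor_sum k DIM('a) (\<lambda>i j. u j \<bullet> h i) = (\<Sum>J | J \<subseteq> {..<DIM('a)} \<and> card J = k.
     Determinant.det (Matrix.mat k k (\<lambda>(p,q). u (pick J p) \<bullet> u (pick J q))))" if "onb h" for h :: "nat \<Rightarrow> 'a"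
  proof -
    have "(\<Sum>I | I \<subseteq> {..<DIM('a)} \<and> card I = k. (Determinant.det (Matrix.mat k k (\<lambda>(p,q). u (pick J q) \<bullet> h (pick I p))))\<^sup>2) =
      Determinant.det (Matrix.mat k k (\<lambda>(p,q). u (pick J p) \<bullet> u (pick J q)))" for J
      using det_gram_eq_sum_minors[of k "\<lambda>i q. u (pick J q) \<bullet> h i" "DIM('a)"]
      by (simp only: onb_inner[OF that])
    then show ?thesis
      unfolding minor_sum_def by (subst sum.swap) simp
  qed
  from this[OF assms(1)] this[OF assms(2)] show ?thesis by simp
qed

text \<open>Transposition replaces \<open>T\<close> by its adjoint and turns columns into rows, so
  \<open>minor_sum_row_basis\<close> changes the column basis as well.\<close>

lemma minor_sum_basis:
  fixes T :: "'a::euclidean_space \<Rightarrow> 'a"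
  assumes "linear T" "onb e" "onb f" "onb e'" "onb f'"
  shows "minor_sum k DIM('a) (\<lambda>i j. T (e j) \<bullet> f i) = minor_sum k DIM('a) (\<lambda>i j. T (e' j) \<bullet> f' i)"
proof -
  have "minor_sum k DIM('a) (\<lambda>i j. T (e j) \<bullet> f i) = minor_sum k DIM('a) (\<lambda>i j. T (e j) \<bullet> f' i)"
    by (rule minor_sum_row_basis) fact+
  also have "\<dots> = minor_sum k DIM('a) (\<lambda>i j. adjoint T (f' j) \<bullet> e i)"
    by (subst minor_sum_transpose[symmetric]) (simp add: adjoint_works[OF assms(1)] inner_commute)
  also have "\<dots> = minor_sum k DIM('a) (\<lambda>i j. adjoint T (f' j) \<bullet> e' i)"
    by (rule minor_sum_row_basis) fact+
  also have "\<dots> = minor_sum k DIM('a) (\<lambda>i j. T (e' j) \<bullet> f' i)"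
    by (subst minor_sum_transpose[symmetric]) (simp add: adjoint_works[OF assms(1)] inner_commute)
  finally show ?thesis .
qed

lemma onb_of_frame:
  fixes x :: "'a::euclidean_space"
  assumes "orthonormal_frame x e" "norm x = 1"
  shows "onb (e(DIM('a) - 1 := x))"
proof -
  have "e i \<bullet> x = 0" "x \<bullet> e i = 0" if "i < DIM('a) - 1" for i
    using assms(1) that by (simp_all add: orthonormal_frame_def tangent_space_def inner_commute[of x])
  moreover have "x \<bullet> x = 1" using assms(2) by (simp add: norm_eq_1)
  moreover have "i < DIM('a) - 1" if "i < DIM('a)" "i \<noteq> DIM('a) - 1" for i using that by linarith
  ultimately show ?thesis
    using assms(1) by (simp add: onb_def orthonormal_frame_def)
qed

text \<open>The frame picked by \<open>SOME\<close>, completed by \<open>x\<close>, is an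
  orthonormal basis of the ambient space. Since \<open>nabla v x\<close> annihilates
  \<open>x\<close> and has values orthogonal to \<open>x\<close>, the additional row and column are
  zero; after that both bases are free.\<close>

lemma wedge_norm2_eq_minor_sum:
  fixes v :: "'a::euclidean_space \<Rightarrow> 'a"
  assumes x: "x \<in> sphere 0 1" and lin: "linear (nabla v x)" and "nabla v x x = 0" "\<And>h. nabla v x h \<bullet> x = 0"
    and "onb e" "onb f"
  shows "wedge_norm2 k v x = minor_sum k DIM('a) (\<lambda>i j. nabla v x (e j) \<bullet> f i)"
proof -
  define e0 where "e0 = (SOME e. orthonormal_frame x e)"
  have e0: "orthonormal_frame x e0"
    unfolding e0_def using ex_orthonormal_frame[OF x] by (rule someI_ex)
  define N where "N = DIM('a) - 1"
  have N: "DIM('a) = Suc N" unfolding N_def using DIM_positive[where 'a='a] by linarith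
  let ?e = "e0(N := x)"
  have onb: "onb ?e" using onb_of_frame[OF e0] x by (simp add: N_def)
  have "wedge_norm2 k v x = minor_sum k N (\<lambda>i j. nabla v x (e0 j) \<bullet> e0 i)"
    unfolding wedge_norm2_def nabla_mat_def Let_def minor_sum_def e0_def[symmetric] N_def[symmetric]
    by (intro sum.cong refl) (simp add: submatrix_mat[of _ N k _ "\<lambda>i j. nabla v x (e0 j) \<bullet> e0 i"])
  also have "\<dots> = minor_sum k N (\<lambda>i j. nabla v x (?e j) \<bullet> ?e i)"
    by (rule minor_sum_cong) auto
  also have "\<dots> = minor_sum k DIM('a) (\<lambda>i j. nabla v x (?e j) \<bullet> ?e i)"
    unfolding N by (rule minor_sum_zero_border[symmetric]) (use assms in auto)
  also have "\<dots> = minor_sum k DIM('a) (\<lambda>i j. nabla v x (e j) \<bullet> f i)"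
    by (rule minor_sum_basis[OF lin onb onb \<open>onb e\<close> \<open>onb f\<close>])
  finally show ?thesis .
qed

section \<open>Triangular form in a pair of bases and the pointwise bound\<close>

text \<open>In the induction step the first \<open>m\<close> vectors span a proper subspace of the
  \<open>m + 1\<close>-dimensional \<open>S\<close>, so a unit vector of \<open>S\<close> orthogonal
  to them can be the last basis vector; the induction continues in its orthogonal complement within
  \<open>S\<close>. As rows and columns may use different bases, a triangular form does not depend
  on real eigenvalues.\<close>

lemma orthonormal_triangular:
  fixes S :: "'a::euclidean_space set"
  assumes "subspace S" "dim S = m" "\<And>j. j < m \<Longrightarrow> u j \<in> S"
  shows "\<exists>f. (\<forall>i<m. f i \<in> S) \<and> (\<forall>i<m. \<forall>j<m. f i \<bullet> f j = (if i = j then 1 else 0)) \<and>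
    (\<forall>i<m. \<forall>j<i. u j \<bullet> f i = 0)"
  using assms
proof (induction m arbitrary: S)
  case 0
  then show ?case by auto
next
  case (Suc m)
  have sub: "span (u ` {..<m}) \<subseteq> S"
    using Suc.prems by (intro span_minimal) auto
  have "dim (span (u ` {..<m})) \<le> m"
  proof -
    have "dim (u ` {..<m}) \<le> card (u ` {..<m})" by (rule dim_le_card') simp
    also have "\<dots> \<le> m" using card_image_le[of "{..<m}" u] by simp
    finally show ?thesis by (simp only: dim_span)
  qed
  then have "span (u ` {..<m}) \<noteq> S" using Suc.prems(2) by auto
  then obtain z where z: "z \<noteq> 0" "z \<in> S" "\<And>y. y \<in> span (u ` {..<m}) \<Longrightarrow> real_inner_class.orthogonal z y"
  proof -
    have S: "span S = S" using Suc.prems(1) by (simp only: span_eq_iff)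
    have "span (u ` {..<m}) \<subset> span S"
      unfolding S using sub \<open>span (u ` {..<m}) \<noteq> S\<close> by (rule psubsetI)
    from orthogonal_to_subspace_exists_gen[OF this] show ?thesis
      unfolding S using that by blast
  qed
  define w where "w = z /\<^sub>R norm z"
  have w: "norm w = 1" "w \<in> S" "w \<bullet> w = 1"
  proof -
    show "norm w = 1" using z(1) by (simp add: w_def)
    then show "w \<bullet> w = 1" by (simp add: norm_eq_1)
    show "w \<in> S" unfolding w_def using z(2) Suc.prems(1) by (rule subspace_scale[rotated])
  qed
  have uw: "u j \<bullet> w = 0" if "j < m" for j
    using z(3)[of "u j"] that by (auto simp: w_def real_inner_class.orthogonal_def span_base inner_commute)
  define S' where "S' = {y \<in> S. \<forall>x\<in>span {w}. real_inner_class.orthogonal x y}"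
  have S'eq: "S' = {y \<in> S. y \<bullet> w = 0}"
    unfolding S'_def by (auto simp: real_inner_class.orthogonal_def span_singleton inner_commute)
  have "dim S' + dim (span {w}) = dim S"
    unfolding S'_def using w Suc.prems(1) by (intro dim_subspace_orthogonal_to_vectors) (auto simp: span_minimal)
  moreover have "dim (span {w}) = 1" using w(1) by (subst dim_span, subst dim_singleton) auto
  ultimately have dS': "dim S' = m" using Suc.prems(2) by simp
  have sS': "subspace S'"
    unfolding S'eq using Suc.prems(1) by (auto simp: subspace_def inner_add_left)
  obtain f where f: "\<forall>i<m. f i \<in> S'" "\<forall>i<m. \<forall>j<m. f i \<bullet> f j = (if i = j then 1 else 0)"
      "\<forall>i<m. \<forall>j<i. u j \<bullet> f i = 0"
    using Suc.IH[OF sS' dS'] uw Suc.prems(3) by (auto simp: S'eq)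
  show ?case
    by (rule exI[of _ "f(m := w)"]) (use f w uw in \<open>auto simp: S'eq less_Suc_eq inner_commute\<close>)
qed

text \<open>A principal minor of a triangular matrix is the product of the diagonal entries over its
  index set. Complementation permutes the \<open>n\<close>-subsets of the first \<open>2 * n\<close>
  indices, so the doubled sum of squares is bounded below pair by pair, and each pair contributes
  the same full product.\<close>

lemma minor_sum_triangular_ge:
  assumes tri: "\<And>i j. i < N \<Longrightarrow> j < i \<Longrightarrow> a i j = 0" and "2 * n \<le> N"
  shows "real (2 * n choose n) * (\<Prod>i<2*n. \<bar>a i i\<bar>) \<le> minor_sum n N a"
proof -
  let ?S = "{I. I \<subseteq> {..<N} \<and> card I = n}" and ?T = "{I. I \<subseteq> {..<2*n} \<and> card I = n}"
  let ?d = "\<lambda>I J. Determinant.det (Matrix.mat n n (\<lambda>(p,q). a (pick I p) (pick J q)))"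
  define P where "P = (\<lambda>I. \<Prod>i\<in>I. \<bar>a i i\<bar>)"
  have fin: "finite ?S" "finite ?T" by auto
  have ST: "?T \<subseteq> ?S" using assms(2) by auto
  have d: "(?d I I)\<^sup>2 = (P I)\<^sup>2" if I: "I \<in> ?S" for I
  proof -
    have finI: "finite I" and cI: "card I = n" and pI: "p < n \<Longrightarrow> pick I p < N" for p
      using I pick_in_set_le[of p I] finite_subset by auto
    have "?d I I = prod_list (diag_mat (Matrix.mat n n (\<lambda>(p,q). a (pick I p) (pick I q))))"
    proof (rule det_upper_triangular)
      show "upper_triangular (Matrix.mat n n (\<lambda>(p,q). a (pick I p) (pick I q)))"
        using tri pI pick_mono_le[of _ I] cI by (auto simp: upper_triangular_def)
    qed auto
    also have "\<dots> = (\<Prod>p=0..<n. a (pick I p) (pick I p))"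
      unfolding prod_list_diag_prod by (intro prod.cong) auto
    also have "\<dots> = (\<Prod>i\<in>I. a i i)"
      using prod.reindex_bij_betw[OF bij_betw_pick[OF finI], of "\<lambda>i. a i i"] cI by simp
    finally show ?thesis
      by (simp add: P_def flip: abs_prod)
  qed
  have "bij_betw (\<lambda>I. {..<2*n} - I) ?T ?T"
  proof (rule bij_betw_byWitness[where f' = "\<lambda>I. {..<2*n} - I"])
    have "card ({..<2*n} - I) = n" if "I \<subseteq> {..<2*n}" "card I = n" for I
      using that finite_subset[OF that(1)] by (simp add: card_Diff_subset)
    then show "(\<lambda>I. {..<2*n} - I) ` ?T \<subseteq> ?T" "(\<lambda>I. {..<2*n} - I) ` ?T \<subseteq> ?T" by auto
  qed auto
  then have compl: "(\<Sum>I\<in>?T. (P ({..<2*n} - I))\<^sup>2) = (\<Sum>I\<in>?T. (P I)\<^sup>2)"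
    by (rule sum.reindex_bij_betw)
  have "2 * (real (2 * n choose n) * (\<Prod>i<2*n. \<bar>a i i\<bar>)) = (\<Sum>I\<in>?T. 2 * (P I * P ({..<2*n} - I)))"
  proof -
    have "P I * P ({..<2*n} - I) = P {..<2*n}" if "I \<in> ?T" for I
      unfolding P_def using prod.subset_diff[of I "{..<2*n}" "\<lambda>i. \<bar>a i i\<bar>"] that by (simp add: mult.commute)
    then have "(\<Sum>I\<in>?T. 2 * (P I * P ({..<2*n} - I))) = (\<Sum>I\<in>?T. 2 * P {..<2*n})"
      by (intro sum.cong refl) simp
    also have "\<dots> = real (card ?T) * (2 * P {..<2*n})" by (rule sum_constant)
    also have "card ?T = (2 * n choose n)" using n_subsets[of "{..<2*n}" n] by (simp only: card_lessThan finite_lessThan simp_thms)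
    finally show ?thesis unfolding P_def by (simp only: mult_ac)
  qed
  also have "\<dots> \<le> (\<Sum>I\<in>?T. (P I)\<^sup>2 + (P ({..<2*n} - I))\<^sup>2)"
  proof (rule sum_mono)
    show "2 * (P I * P ({..<2*n} - I)) \<le> (P I)\<^sup>2 + (P ({..<2*n} - I))\<^sup>2" for I
      using sum_squares_bound[of "P I" "P ({..<2*n} - I)"] by (simp only: mult.assoc)
  qed
  also have "\<dots> = 2 * (\<Sum>I\<in>?T. (P I)\<^sup>2)" by (simp add: sum.distrib compl)
  also have "(\<Sum>I\<in>?T. (P I)\<^sup>2) \<le> (\<Sum>I\<in>?S. (P I)\<^sup>2)"
    using fin ST by (intro sum_mono2) auto
  also have "\<dots> = (\<Sum>I\<in>?S. (?d I I)\<^sup>2)" using d by simp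
  also have "\<dots> \<le> (\<Sum>I\<in>?S. \<Sum>J\<in>?S. (?d I J)\<^sup>2)"
    using fin by (intro sum_mono member_le_sum) auto
  finally show ?thesis by (simp add: minor_sum_def)
qed

text \<open>\<open>f\<close> is an orthonormal basis of the complement of \<open>x\<close> and
  \<open>v\<close>, triangular relative to \<open>u\<close>. It is completed in both orders of
  \<open>x\<close> and \<open>v\<close>, because \<open>minor_sum_ge_det\<close> takes one order for
  the columns and the other for the rows.\<close>

lemma orthonormal_pair_basis:
  fixes x v :: "'a::euclidean_space"
  assumes DIM: "DIM('a) = m + 2" and xv: "norm x = 1" "norm v = 1" "v \<bullet> x = 0"
    and u: "\<And>j. j < m \<Longrightarrow> u j \<bullet> x = 0 \<and> u j \<bullet> v = 0"
  obtains f where "onb (f(m := v, Suc m := x))" "onb (f(m := x, Suc m := v))"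
    "\<And>i j. i < m \<Longrightarrow> j < i \<Longrightarrow> u j \<bullet> f i = 0"
proof -
  define S where "S = {y. \<forall>z\<in>span {x, v}. real_inner_class.orthogonal z y}"
  have Seq: "y \<in> S \<longleftrightarrow> y \<bullet> x = 0 \<and> y \<bullet> v = 0" for y
  proof
    assume "y \<in> S"
    then show "y \<bullet> x = 0 \<and> y \<bullet> v = 0"
      unfolding S_def real_inner_class.orthogonal_def
      by (simp add: inner_commute span_base)
  next
    assume y: "y \<bullet> x = 0 \<and> y \<bullet> v = 0"
    have "real_inner_class.orthogonal y z" if "z \<in> span {x, v}" for z
      using that y by (intro orthogonal_to_span[of z "{x, v}"]) (auto simp: real_inner_class.orthogonal_def)
    then show "y \<in> S"
      unfolding S_def by (simp add: orthogonal_commute)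
  qed
  have "x \<noteq> v" using xv by (metis inner_eq_zero_iff norm_zero zero_neq_one)
  have "independent {x, v}"
    using xv by (intro pairwise_orthogonal_independent) (auto simp: pairwise_def real_inner_class.orthogonal_def inner_commute)
  then have "dim (span {x, v}) = 2" using \<open>x \<noteq> v\<close> by (simp add: dim_eq_card_independent)
  moreover have "dim {y \<in> UNIV. \<forall>z\<in>span {x, v}. real_inner_class.orthogonal z y} + dim (span {x, v}) = dim (UNIV :: 'a set)"
    by (rule dim_subspace_orthogonal_to_vectors) auto
  ultimately have dS: "dim S = m" using DIM by (simp add: S_def)
  have sS: "subspace S" by (auto simp: subspace_def Seq inner_add_left)
  obtain f where f: "\<And>i. i < m \<Longrightarrow> f i \<in> S" "\<And>i j. i<m \<Longrightarrow> j<m \<Longrightarrow> f i \<bullet> f j = (if i = j then 1 else 0)"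
    "\<And>i j. i < m \<Longrightarrow> j < i \<Longrightarrow> u j \<bullet> f i = 0"
  proof -
    have uS: "\<And>j. j < m \<Longrightarrow> u j \<in> S" using u by (simp add: Seq)
    have "\<exists>f. (\<forall>i<m. f i \<in> S) \<and> (\<forall>i<m. \<forall>j<m. f i \<bullet> f j = (if i = j then 1 else 0)) \<and>
        (\<forall>i<m. \<forall>j<i. u j \<bullet> f i = 0)"
      by (rule orthonormal_triangular[OF sS dS]) (rule uS)
    then obtain f where "\<forall>i<m. f i \<in> S" "\<forall>i<m. \<forall>j<m. f i \<bullet> f j = (if i = j then 1 else 0)"
        "\<forall>i<m. \<forall>j<i. u j \<bullet> f i = 0" by (elim exE conjE)
    then show ?thesis by (intro that[of f]) simp_all
  qed
  have n: "x \<bullet> x = 1" "v \<bullet> v = 1" "x \<bullet> v = 0" using xv by (simp_all add: norm_eq_1 inner_commute)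
  have fx: "f i \<bullet> x = 0" "f i \<bullet> v = 0" "x \<bullet> f i = 0" "v \<bullet> f i = 0" if "i < m" for i
    using f(1)[OF that] by (simp_all add: Seq inner_commute)
  show ?thesis
  proof (rule that[of f])
    show "onb (f(m := v, Suc m := x))" "onb (f(m := x, Suc m := v))"
    proof -
      have DS: "DIM('a) = Suc (Suc m)" using DIM by simp
      have lt: "i < m \<or> i = m \<or> i = Suc m" if "i < Suc (Suc m)" for i using that by linarith
      have "(f(m := a, Suc m := b)) i \<bullet> (f(m := a, Suc m := b)) j = (if i = j then 1 else 0)"
        if "i < Suc (Suc m)" "j < Suc (Suc m)" "a = x \<and> b = v \<or> a = v \<and> b = x" for a b i j
        using lt[OF that(1)] lt[OF that(2)] that(3) fx n f(2) xv(3) by (elim disjE conjE) simp_all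
      then show "onb (f(m := v, Suc m := x))" "onb (f(m := x, Suc m := v))"
        unfolding onb_def DS by simp_all
    qed
  qed (rule f(3))
qed

text \<open>In the application \<open>T = \<nabla>v\<close> and \<open>D = Dw\<close>, both at \<open>x\<close>.\<close>

lemma minor_sum_ge_det:
  fixes T :: "'a::euclidean_space \<Rightarrow> 'a"
  assumes DIM: "DIM('a) = 2 * n + 2" and xv: "norm x = 1" "norm v = 1" "v \<bullet> x = 0"
    and T: "T x = 0" "\<And>h. T h \<bullet> x = 0" "\<And>h. T h \<bullet> v = 0"
    and D: "\<And>h. D h = (h \<bullet> x) *\<^sub>R v + T h - (h \<bullet> v) *\<^sub>R x"
  obtains e f where "onb e" "onb f" "\<And>i j. i < DIM('a) \<Longrightarrow> j < i \<Longrightarrow> D (e j) \<bullet> f i = 0"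
    "real (2 * n choose n) * (\<Prod>i<DIM('a). \<bar>D (e i) \<bullet> f i\<bar>) \<le> minor_sum n DIM('a) (\<lambda>i j. T (e j) \<bullet> f i)"
proof -
  have le: "2 * n \<le> DIM('a)" using DIM by linarith
  define m where "m = 2 * n"
  have D2: "DIM('a) = m + 2" and DS: "DIM('a) = Suc (Suc m)" using DIM by (simp_all add: m_def)
  \<comment> \<open>The choice \<open>u = 0\<close> imposes no condition: any completion serves for
    the columns, and the rows are then adapted to the images \<open>T (e j)\<close>.\<close>
  obtain e where e: "onb (e(m := v, Suc m := x))"
    by (rule orthonormal_pair_basis[OF D2 xv, where u = "\<lambda>_. 0"]) (simp, rule that)
  obtain f where f: "onb (f(m := x, Suc m := v))" and tri: "\<And>i j. i < m \<Longrightarrow> j < i \<Longrightarrow> T (e j) \<bullet> f i = 0"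
    by (rule orthonormal_pair_basis[OF D2 xv, where u = "\<lambda>j. T (e j)"]) (use T(2,3) in simp, rule that)
  \<comment> \<open>With the last columns \<open>v, x\<close> and the last rows \<open>x, v\<close>,
    the corner of \<open>D\<close> has the diagonal entries \<open>D v \<bullet> x = -1\<close> and
    \<open>D x \<bullet> v = 1\<close>, and \<open>D v \<bullet> v = 0\<close> below the diagonal.
    So the last two entries leave the absolute value of the product unchanged.\<close>
  let ?e = "e(m := v, Suc m := x)" and ?f = "f(m := x, Suc m := v)"
  have ex: "e j \<bullet> x = 0" "e j \<bullet> v = 0" if "j < m" for j
    using e[unfolded onb_def, rule_format, of j m] e[unfolded onb_def, rule_format, of j "Suc m"] DS that
    by simp_all
  have n: "x \<bullet> x = 1" "v \<bullet> v = 1" "x \<bullet> v = 0" using xv by (simp_all add: norm_eq_1 inner_commute)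
  have De: "D (e j) = T (e j)" if "j < m" for j using ex[OF that] by (simp add: D)
  have Dv: "D v = T v - x" and Dx: "D x = v" using n xv(3) T(1) by (simp_all add: D)
  have cases_i: "i < m \<or> i = m \<or> i = Suc m" if "i < DIM('a)" for i
    using that unfolding DS by linarith
  have "D (?e j) \<bullet> ?f i = 0" if ij: "i < DIM('a)" "j < i" for i j
  proof -
    consider (lt) "i < m" | (m) "i = m" | (Sm) "i = Suc m" using cases_i[OF ij(1)] by blast
    then show ?thesis
    proof cases
    case lt
    then show ?thesis using De tri ij by simp
  next
    case m
    then show ?thesis using De T(2) ij by simp
  next
    case Sm
    then consider "j < m" | "j = m" using \<open>j < i\<close> by linarith
    then show ?thesis using De Dv T(3) n Sm by cases (simp_all add: inner_diff_left)
  qed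
  qed
  moreover have "T (?e j) \<bullet> ?f i = 0" if "i < DIM('a)" "j < i" for i j
    using cases_i[OF that(1)] tri[of i j] that T(2,3) by (elim disjE) simp_all
  then have "real (2 * n choose n) * (\<Prod>i<m. \<bar>T (?e i) \<bullet> ?f i\<bar>) \<le> minor_sum n DIM('a) (\<lambda>i j. T (?e j) \<bullet> ?f i)"
    unfolding m_def using le by (rule minor_sum_triangular_ge)
  moreover have "(\<Prod>i<DIM('a). \<bar>D (?e i) \<bullet> ?f i\<bar>) = (\<Prod>i<m. \<bar>T (?e i) \<bullet> ?f i\<bar>)"
  proof -
    have "(\<Prod>i<DIM('a). \<bar>D (?e i) \<bullet> ?f i\<bar>) = (\<Prod>i<m. \<bar>D (?e i) \<bullet> ?f i\<bar>) * \<bar>D v \<bullet> x\<bar> * \<bar>D x \<bullet> v\<bar>"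
      unfolding DS prod.lessThan_Suc by simp
    also have "\<dots> = (\<Prod>i<m. \<bar>D (?e i) \<bullet> ?f i\<bar>)" using Dv Dx T(2) n by (simp add: inner_diff_left)
    also have "(\<Prod>i<m. \<bar>D (?e i) \<bullet> ?f i\<bar>) = (\<Prod>i<m. \<bar>T (?e i) \<bullet> ?f i\<bar>)"
      by (intro prod.cong refl) (use De in simp)
    finally show ?thesis .
  qed
  ultimately show ?thesis using that[OF e f] by (simp only:)
qed

text \<open>Only \<open>J = I\<close> contributes, with an identity submatrix: distinct sets of
  equal size leave some index of \<open>I\<close> outside \<open>J\<close>, which gives a zero row.
  This counts the \<open>n\<close>-subsets of \<open>{..<2*n}\<close>.\<close>

lemma minor_sum_truncated_identity:
  assumes a: "\<And>i j. i < 2 * n + 2 \<Longrightarrow> j < 2 * n + 2 \<Longrightarrow> a i j = (if i = j \<and> i < 2 * n then 1 else 0)"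
  shows "minor_sum n (2 * n + 2) a = real (2 * n choose n)"
proof -
  let ?b = "\<lambda>i j. if i = j \<and> i < 2 * n then 1 else 0 :: real"
  let ?T = "{I. I \<subseteq> {..<2*n} \<and> card I = n}"
  let ?d = "\<lambda>I J. Determinant.det (Matrix.mat n n (\<lambda>(p,q). ?b (pick I p) (pick J q)))"
  have "minor_sum n (2 * n + 2) a = minor_sum n (2 * n + 2) ?b"
    by (rule minor_sum_cong) (use a in simp)
  also have "\<dots> = minor_sum n (2 * n) ?b"
    using minor_sum_zero_border[of "Suc (2*n)" ?b n] minor_sum_zero_border[of "2*n" ?b n] by simp
  also have "\<dots> = (\<Sum>I\<in>?T. 1)"
    unfolding minor_sum_def
  proof (rule sum.cong[OF refl])
    fix I assume I: "I \<in> ?T"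
    have cI: "card I = n" using I by simp
    have pk: "pick I p \<in> I" "pick I p < 2 * n" if "p < n" for p
      using pick_in_set_le[of p I] that I by auto
    have "(?d I J)\<^sup>2 = (if J = I then 1 else 0)" if J: "J \<in> ?T" for J
    proof (cases "J = I")
      case True
      have "?b (pick I p) (pick I q) = (if p = q then 1 else 0)" if "p < n" "q < n" for p q
      proof -
        have "p = q" if "pick I p = pick I q"
          using that pick_mono_le[of p I q] pick_mono_le[of q I p] \<open>p < n\<close> \<open>q < n\<close> cI
          by (metis less_irrefl linorder_neqE_nat)
        then show ?thesis using pk(2)[OF \<open>p < n\<close>] by metis
      qed
      then have "Matrix.mat n n (\<lambda>(p,q). ?b (pick I p) (pick I q)) = 1\<^sub>m n"
        by (intro eq_matI) auto
      then show ?thesis using True by simp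
    next
      case False
      have fin: "finite I" "finite J" using I J finite_subset[OF _ finite_lessThan] by auto
      have "\<not> I \<subseteq> J" using False I J fin card_subset_eq[of J I] by auto
      then obtain i where i: "i \<in> I" "i \<notin> J" by auto
      have "card I = n" using I by simp
      with i obtain p where p: "p < n" "pick I p = i" using pick_surj[OF i(1) fin(1)] by metis
      have "?d I J = 0"
      proof (rule det_mat_zero_row[OF p(1)])
        fix q assume "q < n"
        then have "pick J q \<in> J" using pick_in_set_le[of q J] J by auto
        then have "(pick I p = pick J q) = False" using i(2) p(2) by metis
        then show "?b (pick I p) (pick J q) = 0" by (simp only: simp_thms if_False)
      qed
      then show ?thesis using False by simp
    qed
    then have "(\<Sum>J\<in>?T. (?d I J)\<^sup>2) = (\<Sum>J\<in>?T. if J = I then 1 else 0)"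
      by (rule sum.cong[OF refl])
    also have "\<dots> = (if I \<in> ?T then 1 else 0)" by (rule sum.delta) simp
    finally show "(\<Sum>J\<in>?T. (?d I J)\<^sup>2) = 1" using I by (simp only: if_True)
  qed
  also have "\<dots> = real (card ?T)" by (rule real_of_card[symmetric])
  also have "card ?T = (2 * n choose n)"
    using n_subsets[of "{..<2*n}" n] by (simp only: card_lessThan finite_lessThan simp_thms)
  finally show ?thesis .
qed

section \<open>The integral of the Jacobian of a homogeneous field\<close>

text \<open>The mean value inequality applies on segments that avoid the origin. If the segment
  contains the origin, then \<open>norm (a - b) = norm a + norm b\<close>, and norm preservation
  with \<open>1 \<le> L\<close> suffices.\<close>

lemma lipschitz_away_from_origin:
  fixes w :: "'a::euclidean_space \<Rightarrow> 'a"
  assumes der: "\<And>y. y \<noteq> 0 \<Longrightarrow> (w has_derivative w' y) (at y)"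
    and bd: "\<And>y h. y \<noteq> 0 \<Longrightarrow> norm (w' y h) \<le> L * norm h"
    and nrm: "\<And>y. norm (w y) = norm y" and "1 \<le> L"
  shows "norm (w a - w b) \<le> L * norm (a - b)"
proof (cases "0 \<in> closed_segment a b")
  case True
  then have "norm (a - b) = norm a + norm b"
    using between[of a b 0] between_mem_segment[of a b 0] by (simp add: dist_norm)
  moreover have "norm (w a - w b) \<le> norm a + norm b"
    using norm_triangle_ineq4[of "w a" "w b"] by (simp add: nrm)
  moreover have "norm (a - b) \<le> L * norm (a - b)"
    using \<open>1 \<le> L\<close> mult_right_mono[of 1 L "norm (a - b)"] by simp
  ultimately show ?thesis by linarith
next
  case False
  show ?thesis
  proof (rule differentiable_bound[where S = "closed_segment a b" and f' = w'])
    fix x assume "x \<in> closed_segment a b"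
    then have "x \<noteq> 0" using False by blast
    then show "(w has_derivative w' x) (at x within closed_segment a b)"
      using der has_derivative_at_withinI by blast
    show "onorm (w' x) \<le> L" using bd[OF \<open>x \<noteq> 0\<close>] by (rule onorm_le)
  qed auto
qed

text \<open>Injectivity: the linear part expands by more than \<open>w\<close> can compensate.
  Surjectivity: \<open>y\<close> solves \<open>s y + w y = z\<close> exactly if it is fixed by the
  contraction sending \<open>y\<close> to \<open>(z - w y) / s\<close>. Orthogonality and equal
  length make the norm scale by exactly \<open>sqrt (s^2 + 1)\<close>, so the punctured balls
  correspond.\<close>

lemma bij_betw_scaled_perturbation:
  fixes w :: "'a::euclidean_space \<Rightarrow> 'a"
  assumes lip: "\<And>a b. norm (w a - w b) \<le> L * norm (a - b)"
    and nrm: "\<And>y. norm (w y) = norm y" and orth: "\<And>y. w y \<bullet> y = 0" and s: "L < s" "0 \<le> L"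
  shows "bij_betw (\<lambda>y. s *\<^sub>R y + w y) (ball 0 1 - {0}) (ball 0 (sqrt (s\<^sup>2 + 1)) - {0})"
proof -
  let ?F = "\<lambda>y. s *\<^sub>R y + w y"
  have "s > 0" using s by linarith
  have inj: "a = b" if "?F a = ?F b" for a b
  proof -
    have "s *\<^sub>R (a - b) = - (w a - w b)" using that by (simp add: algebra_simps)
    then have "norm (s *\<^sub>R (a - b)) = norm (w a - w b)" by (simp only: norm_minus_cancel)
    then have "s * norm (a - b) \<le> L * norm (a - b)" using lip[of a b] \<open>s > 0\<close> by simp
    then show "a = b" using s by (metis eq_iff_diff_eq_0 mult_le_cancel_right not_le norm_eq_zero norm_le_zero_iff)
  qed
  have surj: "\<exists>y. ?F y = z" for z
  proof -
    have "\<exists>!y. (z - w y) /\<^sub>R s = y"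
    proof (rule banach_fix_type)
      show "0 \<le> L / s" "L / s < 1" using s \<open>s > 0\<close> by simp_all
      show "\<forall>x y. dist ((z - w x) /\<^sub>R s) ((z - w y) /\<^sub>R s) \<le> L / s * dist x y"
      proof (intro allI)
        fix x y
        have "dist ((z - w x) /\<^sub>R s) ((z - w y) /\<^sub>R s) = norm (w x - w y) / s"
          using \<open>s > 0\<close> by (simp add: dist_norm scaleR_diff_right[symmetric] norm_minus_commute divide_inverse mult.commute)
        also have "\<dots> \<le> L * norm (x - y) / s" using lip \<open>s > 0\<close> by (simp add: divide_right_mono)
        finally show "dist ((z - w x) /\<^sub>R s) ((z - w y) /\<^sub>R s) \<le> L / s * dist x y"
          by (simp add: dist_norm)
      qed
    qed
    then obtain y where y: "(z - w y) /\<^sub>R s = y" by blast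
    have "s *\<^sub>R y = s *\<^sub>R ((z - w y) /\<^sub>R s)" using y by simp
    also have "\<dots> = z - w y" using \<open>s > 0\<close> by simp
    finally have "?F y = z" by simp
    then show ?thesis ..
  qed
  have nF: "norm (?F y) = sqrt (s\<^sup>2 + 1) * norm y" for y
  proof -
    have "?F y \<bullet> ?F y = (s\<^sup>2 + 1) * (norm y)\<^sup>2"
    proof -
      have "?F y \<bullet> ?F y = s\<^sup>2 * (y \<bullet> y) + 2 * s * (w y \<bullet> y) + w y \<bullet> w y"
        unfolding inner_add_left inner_add_right inner_scaleR_left inner_scaleR_right inner_commute[of y "w y"]
        by (simp add: power2_eq_square distrib_left)
      then show ?thesis using orth[of y] nrm[of y] by (simp only: dot_square_norm) (simp add: algebra_simps power2_eq_square)
    qed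
    then show ?thesis by (simp add: norm_eq_sqrt_inner[of "?F y"] real_sqrt_mult)
  qed
  have p: "sqrt (s\<^sup>2 + 1) > 0" by (simp add: add_nonneg_pos)
  have mem: "?F y \<in> ball 0 (sqrt (s\<^sup>2 + 1)) - {0} \<longleftrightarrow> y \<in> ball 0 1 - {0}" for y
  proof -
    have "norm (?F y) = 0 \<longleftrightarrow> norm y = 0" using p unfolding nF by simp
    moreover have "norm (?F y) < sqrt (s\<^sup>2 + 1) \<longleftrightarrow> norm y < 1"
      unfolding nF using mult_less_cancel_left_pos[OF p, of "norm y" 1] by simp
    ultimately show ?thesis by simp
  qed
  show ?thesis
    unfolding bij_betw_def
  proof
    show "inj_on ?F (ball 0 1 - {0})" using inj by (auto intro: inj_onI)
    show "?F ` (ball 0 1 - {0}) = ball 0 (sqrt (s\<^sup>2 + 1)) - {0}"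
    proof (intro subset_antisym subsetI)
      fix z assume "z \<in> ?F ` (ball 0 1 - {0})"
      then obtain y where "y \<in> ball 0 1 - {0}" "z = ?F y" by (rule imageE)
      then show "z \<in> ball 0 (sqrt (s\<^sup>2 + 1)) - {0}" by (simp only: mem)
    next
      fix z :: 'a assume z: "z \<in> ball 0 (sqrt (s\<^sup>2 + 1)) - {0}"
      obtain y where "?F y = z" using surj by (rule exE)
      with z show "z \<in> ?F ` (ball 0 1 - {0})" using mem[of y] by blast
    qed
  qed
qed

text \<open>Along \<open>s + t A\<close> with \<open>t\<close> from 0 to 1 no kernel can appear,
  since \<open>L < s\<close>; the determinant starts at a positive power of \<open>s\<close> and by
  continuity keeps its sign. This removes the absolute value from the change of variables
  formula.\<close>

lemma det_scaled_perturbation_pos: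
  fixes A :: "real^'n \<Rightarrow> real^'n"
  assumes lin: "linear A" and bd: "\<And>h. norm (A h) \<le> L * norm h" and s: "L < s" "0 \<le> L"
  shows "0 < Determinants.det (matrix (\<lambda>h. s *\<^sub>R h + A h))"
proof -
  define f where "f = (\<lambda>t h. s *\<^sub>R h + t *\<^sub>R A h)"
  have lf: "linear (f t)" for t
    unfolding f_def using lin by (intro linear_compose_add linear_compose_scale_right linear_id[unfolded id_def])
  have nz: "Determinants.det (matrix (f t)) \<noteq> 0" if "0 \<le> t" "t \<le> 1" for t
  proof -
    have "h = 0" if "f t h = 0" for h
    proof -
      have "s *\<^sub>R h = - (t *\<^sub>R A h)" using that unfolding f_def by (rule eq_neg_iff_add_eq_0[THEN iffD2])
      then have "norm (s *\<^sub>R h) = norm (t *\<^sub>R A h)" by (simp only: norm_minus_cancel)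
      then have "s * norm h = t * norm (A h)" using s \<open>0 \<le> t\<close> by simp
      also have "\<dots> \<le> 1 * norm (A h)" using \<open>t \<le> 1\<close> by (intro mult_right_mono) auto
      also have "\<dots> \<le> L * norm h" using bd by simp
      finally show "h = 0" using s by (metis mult_le_cancel_right not_le norm_eq_zero norm_le_zero_iff)
    qed
    then have "inj (f t)" using linear_injective_0[OF lf] by blast
    then show ?thesis using det_nz_iff_inj[OF lf] by simp
  qed
  have cont: "continuous_on {0..1} (\<lambda>t. Determinants.det (matrix (f t)))"
    unfolding Determinants.det_def matrix_def f_def
    by (simp, intro continuous_intros)
  have "f 0 = (\<lambda>h. s *\<^sub>R h)" by (simp add: f_def)
  then have "matrix (f 0) = (\<chi> i j. if i = j then s else 0)"
    by (auto simp: matrix_def axis_def vec_eq_iff fun_eq_iff)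
  then have "Determinants.det (matrix (f 0)) = s ^ CARD('n)"
    by (subst det_diagonal) simp_all
  then have pos0: "Determinants.det (matrix (f 0)) > 0" using s by simp
  have "Determinants.det (matrix (f 1)) > 0"
  proof (rule ccontr)
    assume "\<not> ?thesis"
    then have "\<exists>t\<ge>0. t \<le> 1 \<and> Determinants.det (matrix (f t)) = 0"
      using pos0 by (intro IVT2'[OF _ _ _ cont]) auto
    then show False using nz by blast
  qed
  then show ?thesis by (simp add: f_def)
qed

lemma integrable_on_bounded_continuous:
  fixes f :: "'a::euclidean_space \<Rightarrow> real"
  assumes "continuous_on S f" "S \<in> lmeasurable" "\<And>x. x \<in> S \<Longrightarrow> \<bar>f x\<bar> \<le> B"
  shows "f integrable_on S"
proof (rule measurable_bounded_by_integrable_imp_integrable)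
  show "f \<in> borel_measurable (lebesgue_on S)"
    using assms by (intro continuous_imp_measurable_on_sets_lebesgue) (auto simp: fmeasurableD)
  show "(\<lambda>x. B) integrable_on S" using assms(2) by (rule integrable_on_const)
qed (use assms in \<open>auto simp: fmeasurableD\<close>)

section \<open>The integral of the determinant as a polynomial in the shift\<close>

lemma prod_shifted_entries:
  fixes a b :: "'n::finite \<Rightarrow> real"
  shows "(\<Prod>i\<in>UNIV. s * a i + b i) = (\<Sum>X\<in>UNIV. s ^ card X * (\<Prod>i\<in>X. a i) * (\<Prod>i\<in>UNIV - X. b i))"
  by (subst prod_add) (simp_all add: prod.distrib)

text \<open>Expanding each Leibniz product over the set \<open>X\<close> of rows in which the shift
  is taken separates the powers of \<open>s\<close> from the functions \<open>g p X\<close>. These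
  are continuous and bounded, hence integrable, and their integrals supply the coefficients of
  \<open>q\<close>. The point is that one \<open>q\<close> serves for all \<open>s\<close>.\<close>

lemma integral_det_shift_poly:
  fixes B :: "'a::euclidean_space \<Rightarrow> real^'n^'n"
  assumes cont: "\<And>i j. continuous_on S (\<lambda>y. B y $ i $ j)" and S: "S \<in> lmeasurable"
    and bd: "\<And>y i j. y \<in> S \<Longrightarrow> \<bar>B y $ i $ j\<bar> \<le> L"
  shows "\<exists>q. \<forall>s. ((\<lambda>y. Determinants.det (\<chi> i j. s * (if i = j then 1 else 0) + B y $ i $ j)) has_integral poly q s) S"
proof -
  let ?P = "{p. p permutes (UNIV :: 'n set)}"
  let ?d = "\<lambda>i j :: 'n. if i = j then 1 else 0 :: real"
  define g where "g = (\<lambda>p X y. \<Prod>i\<in>UNIV - X. B y $ i $ p i)"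
  define c where "c = (\<lambda>p X. of_int (sign p) * (\<Prod>i\<in>X. ?d i (p i)) :: real)"
  have expand: "Determinants.det (\<chi> i j. s * ?d i j + B y $ i $ j) = (\<Sum>p\<in>?P. \<Sum>X\<in>UNIV. (c p X * s ^ card X) * g p X y)" for s y
    unfolding Determinants.det_def
    by (intro sum.cong refl) (simp add: prod_shifted_entries sum_distrib_left c_def g_def mult_ac)
  have int: "g p X integrable_on S" for p X
  proof (rule integrable_on_bounded_continuous[OF _ S])
    show "continuous_on S (g p X)" unfolding g_def by (intro continuous_intros cont)
    show "\<bar>g p X y\<bar> \<le> (\<Prod>i\<in>UNIV - X. L)" if "y \<in> S" for y
      unfolding g_def abs_prod by (intro prod_mono) (use bd[OF that] in auto)
  qed
  define q where "q = (\<Sum>p\<in>?P. \<Sum>X\<in>UNIV. Polynomial.monom (c p X * integral S (g p X)) (card X))"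
  have "((\<lambda>y. \<Sum>p\<in>?P. \<Sum>X\<in>UNIV. (c p X * s ^ card X) * g p X y) has_integral
        (\<Sum>p\<in>?P. \<Sum>X\<in>UNIV. (c p X * s ^ card X) * integral S (g p X))) S" for s
    by (intro has_integral_sum has_integral_mult_right integrable_integral int) (auto simp: finite_permutations)
  moreover have "(\<Sum>p\<in>?P. \<Sum>X\<in>UNIV. (c p X * s ^ card X) * integral S (g p X)) = poly q s" for s
    unfolding q_def poly_sum poly_monom by (intro sum.cong refl) (simp only: mult_ac)
  ultimately show ?thesis unfolding expand by (intro exI[of _ q] allI) (simp only:)
qed

lemma integral_det_homogeneous_field:
  fixes w :: "real^'n::{finite,wellorder} \<Rightarrow> real^'n::_"
  assumes N: "CARD('n::{finite,wellorder}) = 2 * m"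
    and der: "\<And>y. y \<noteq> 0 \<Longrightarrow> (w has_derivative w' y) (at y)"
    and cont: "\<And>h. continuous_on (- {0}) (\<lambda>y. w' y h)"
    and bd: "\<And>y h. y \<noteq> 0 \<Longrightarrow> norm (w' y h) \<le> L * norm h"
    and nrm: "\<And>y. norm (w y) = norm y" and orth: "\<And>y. w y \<bullet> y = 0"
  shows "((\<lambda>y. Determinants.det (matrix (w' y))) has_integral unit_ball_vol (2 * m)) (ball 0 1 - {0})"
proof -
  \<comment> \<open>\<open>lipschitz_away_from_origin\<close> asks for a constant of at least
    1.\<close>
  define K where "K = max 1 L"
  have K: "1 \<le> K" "0 \<le> K" by (auto simp: K_def)
  have bdK: "norm (w' y h) \<le> K * norm h" if "y \<noteq> 0" for y h
    using bd[OF that, of h] mult_right_mono[of L K "norm h"] by (simp add: K_def)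
  have lip: "norm (w a - w b) \<le> K * norm (a - b)" for a b
    using der bdK nrm K(1) by (rule lipschitz_away_from_origin)
  let ?S = "ball 0 1 - {0} :: (real^'n::_) set"
  have S: "?S \<in> lmeasurable" by (intro lmeasurable_open bounded_Int bounded_diff) auto
  have mat: "matrix (\<lambda>h. s *\<^sub>R h + w' y h) = (\<chi> i j. s * (if i = j then 1 else 0) + matrix (w' y) $ i $ j)" for s y
    by (auto simp: matrix_def axis_def vec_eq_iff)
  have "\<exists>q. \<forall>s. ((\<lambda>y. Determinants.det (\<chi> i j. s * (if i = j then 1 else 0) + matrix (w' y) $ i $ j)) has_integral poly q s) ?S"
  proof (rule integral_det_shift_poly[OF _ S])
    show "continuous_on ?S (\<lambda>y. matrix (w' y) $ i $ j)" for i j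
      unfolding matrix_def using continuous_on_subset[OF cont, of ?S] by (simp add: continuous_on_component subset_iff)
    show "\<bar>matrix (w' y) $ i $ j\<bar> \<le> K" if "y \<in> ?S" for y i j
      using bdK[of y "axis j 1"] component_le_norm_cart[of "w' y (axis j 1)" i] that
      by (simp add: matrix_def norm_axis_1)
  qed
  then obtain q where q: "((\<lambda>y. Determinants.det (matrix (\<lambda>h. s *\<^sub>R h + w' y h))) has_integral poly q s) ?S" for s
    unfolding mat by blast
  define V where "V = unit_ball_vol (2 * m)"
  \<comment> \<open>The value at \<open>s\<close> is the volume of the ball of radius
    \<open>sqrt (s^2 + 1)\<close> in dimension \<open>2 * m\<close>; the even dimension makes it a
    polynomial in \<open>s\<close>.\<close>
  define r where "r = Polynomial.smult V ([:1, 0, 1:] ^ m)"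
  have "poly q s = poly r s" if s: "K < s" for s
  proof -
    have "s > 0" using s K by linarith
    let ?F = "\<lambda>y. s *\<^sub>R y + w y"
    let ?R = "sqrt (s\<^sup>2 + 1)"
    have bij: "bij_betw ?F ?S (ball 0 ?R - {0})"
      using lip nrm orth s K(2) by (rule bij_betw_scaled_perturbation)
    have img: "?F ` ?S = ball 0 ?R - {0}" and inj: "inj_on ?F ?S" using bij by (auto simp: bij_betw_def)
    have "?F ` ?S \<in> lmeasurable" unfolding img by (intro lmeasurable_open bounded_diff) auto
    then have "((\<lambda>y. \<bar>Determinants.det (matrix (\<lambda>h. s *\<^sub>R h + w' y h))\<bar>) has_integral measure lebesgue (?F ` ?S)) ?S"
    proof (subst has_measure_differentiable_image[symmetric, of ?S ?F "\<lambda>y h. s *\<^sub>R h + w' y h" "measure lebesgue (?F ` ?S)"])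
      fix y assume "y \<in> ?S"
      then have "(w has_derivative w' y) (at y within ?S)" by (intro has_derivative_at_withinI[OF der]) simp
      then show "(?F has_derivative (\<lambda>h. s *\<^sub>R h + w' y h)) (at y within ?S)"
        by (intro has_derivative_add has_derivative_scaleR_right has_derivative_ident)
    qed (use inj S in \<open>auto simp: fmeasurableD\<close>)
    moreover have "\<bar>Determinants.det (matrix (\<lambda>h. s *\<^sub>R h + w' y h))\<bar> = Determinants.det (matrix (\<lambda>h. s *\<^sub>R h + w' y h))"
      if "y \<in> ?S" for y
    proof -
      have "linear (w' y)" using that by (intro has_derivative_linear[OF der]) simp
      then have "0 < Determinants.det (matrix (\<lambda>h. s *\<^sub>R h + w' y h))"
        using bdK[of y] that s K by (intro det_scaled_perturbation_pos) auto
      then show ?thesis by (rule abs_of_pos)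
    qed
    ultimately have "((\<lambda>y. Determinants.det (matrix (\<lambda>h. s *\<^sub>R h + w' y h))) has_integral measure lebesgue (?F ` ?S)) ?S"
      by (rule has_integral_eq[rotated])
    then have "poly q s = measure lebesgue (ball 0 ?R - {0} :: (real^'n::_) set)"
      unfolding img by (rule has_integral_unique[OF q])
    also have "\<dots> = measure lebesgue (ball 0 ?R :: (real^'n::_) set)"
      by (rule measure_Diff_null_set) auto
    also have "\<dots> = measure lborel (ball 0 ?R :: (real^'n::_) set)"
      by (rule measure_completion) simp
    also have "\<dots> = unit_ball_vol DIM(real^'n::_) * ?R ^ DIM(real^'n::_)"
      by (rule content_ball) simp
    also have "\<dots> = V * ?R ^ (2 * m)"
      by (simp add: N V_def)
    also have "?R ^ (2 * m) = (s\<^sup>2 + 1) ^ m" by (simp add: power_mult)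
    finally show ?thesis by (simp add: r_def power2_eq_square algebra_simps)
  qed
  \<comment> \<open>The change of variables covers only \<open>s > K\<close>, but agreement on an
    infinite set identifies the polynomials. At \<open>s = 0\<close> the integrand is the Jacobian
    itself.\<close>
  then have "{K<..} \<subseteq> {s. poly (q - r) s = 0}" by (intro subsetI) simp
  moreover have "infinite {K<..}" by (rule infinite_Ioi)
  ultimately have "q - r = 0" using poly_roots_finite[of "q - r"] finite_subset by metis
  then have "q = r" by (simp only: right_minus_eq)
  then have "poly q 0 = V" by (simp add: r_def poly_power)
  then show ?thesis using q[of 0] by (simp add: V_def)
qed

section \<open>Orthonormal coordinates\<close>

text \<open>Change of variables is only available on \<open>real^'n\<close> with \<open>'n\<close> finite and well-ordered, hence an
  index type with \<open>DIM('a)\<close> elements.\<close>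

typedef (overloaded) 'a coord = "{..<DIM('a::euclidean_space)}"
  using DIM_positive by blast

instantiation coord :: (euclidean_space) linorder
begin
definition "i \<le> j \<longleftrightarrow> Rep_coord i \<le> Rep_coord j"
definition "i < j \<longleftrightarrow> Rep_coord i < Rep_coord j"
instance
  by standard (auto simp: less_eq_coord_def less_coord_def Rep_coord_inject)
end

lemma bij_betw_Rep_coord: "bij_betw Rep_coord (UNIV :: 'a::euclidean_space coord set) {..<DIM('a)}"
  by (metis UNIV_I bij_betw_def inj_onI Rep_coord_inject type_definition.Rep_range type_definition_coord)

instance coord :: (euclidean_space) finite
  by standard (metis bij_betw_Rep_coord bij_betw_finite finite_lessThan)

instance coord :: (euclidean_space) wellorder
proof
  fix P :: "'a coord \<Rightarrow> bool" and a
  assume step: "\<And>x. (\<And>y. y < x \<Longrightarrow> P y) \<Longrightarrow> P x"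
  show "P a"
  proof (induction "Rep_coord a" arbitrary: a rule: less_induct)
    case less
    show ?case by (rule step, rule less) (simp only: less_coord_def)
  qed
qed

lemma Rep_coord_less: "Rep_coord (i :: 'a::euclidean_space coord) < DIM('a)"
  using Rep_coord[of i] by simp

lemma card_coord: "CARD('a::euclidean_space coord) = DIM('a)"
  using bij_betw_same_card[OF bij_betw_Rep_coord] by simp

definition from_coords :: "(nat \<Rightarrow> 'a::euclidean_space) \<Rightarrow> real^'a coord \<Rightarrow> 'a" where
  "from_coords e z = (\<Sum>i\<in>UNIV. z $ i *\<^sub>R e (Rep_coord i))"

definition to_coords :: "(nat \<Rightarrow> 'a::euclidean_space) \<Rightarrow> 'a \<Rightarrow> real^'a coord" where
  "to_coords e x = (\<chi> i. x \<bullet> e (Rep_coord i))"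

lemma linear_from_coords: "linear (from_coords e)"
  unfolding from_coords_def by (intro linearI) (simp_all add: scaleR_add_left sum.distrib scaleR_sum_right)

lemma linear_to_coords: "linear (to_coords e)"
  by (intro linearI) (simp_all add: to_coords_def Finite_Cartesian_Product.vec_eq_iff inner_add_left)

lemma inner_onb_coord:
  fixes e :: "nat \<Rightarrow> 'a::euclidean_space" and i j :: "'a coord"
  assumes "onb e"
  shows "e (Rep_coord i) \<bullet> e (Rep_coord j) = (if i = j then 1 else 0)"
  using assms Rep_coord_less[of i] Rep_coord_less[of j] by (simp add: onb_def Rep_coord_inject)

lemma from_coords_inner:
  assumes "onb e"
  shows "from_coords e z \<bullet> e (Rep_coord i) = z $ i"
  unfolding from_coords_def inner_sum_left
  by (simp add: inner_onb_coord[OF assms] if_distrib[of "\<lambda>x. _ * x"] cong: if_cong)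

lemma to_from_coords: "onb e \<Longrightarrow> to_coords e (from_coords e z) = z"
  by (simp add: to_coords_def from_coords_inner Finite_Cartesian_Product.vec_eq_iff)

lemma to_coords_inner:
  fixes e :: "nat \<Rightarrow> 'a::euclidean_space"
  assumes "onb e"
  shows "to_coords e x \<bullet> to_coords e y = x \<bullet> y"
proof -
  have "to_coords e x \<bullet> to_coords e y = (\<Sum>i\<in>UNIV. (x \<bullet> e (Rep_coord (i :: 'a coord))) * (y \<bullet> e (Rep_coord i)))"
    by (simp add: to_coords_def inner_vec_def)
  also have "\<dots> = x \<bullet> y"
    using sum.reindex_bij_betw[OF bij_betw_Rep_coord[where 'a='a], of "\<lambda>i. (x \<bullet> e i) * (y \<bullet> e i)"]
    by (simp only: onb_inner[OF assms])
  finally show ?thesis .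
qed

lemma norm_to_coords: "onb e \<Longrightarrow> norm (to_coords e x) = norm x"
  by (simp add: norm_eq_sqrt_inner to_coords_inner)

lemma from_to_coords:
  assumes "onb e"
  shows "from_coords e (to_coords e x) = x"
proof -
  have "to_coords e (from_coords e (to_coords e x) - x) = 0"
    by (simp add: linear_diff[OF linear_to_coords] to_from_coords[OF assms])
  then have "norm (from_coords e (to_coords e x) - x) = 0"
    using norm_to_coords[OF assms, of "from_coords e (to_coords e x) - x"] by simp
  then show ?thesis by simp
qed

lemma norm_from_coords: "onb e \<Longrightarrow> norm (from_coords e z) = norm z"
  by (metis norm_to_coords to_from_coords)

lemma from_coords_inner_from_coords: "onb e \<Longrightarrow> from_coords e y \<bullet> from_coords e z = y \<bullet> z"
  by (metis to_coords_inner to_from_coords)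

lemma orthogonal_change_of_coords:
  assumes "onb e" "onb f"
  shows "orthogonal_transformation (\<lambda>z. to_coords f (from_coords e z))"
  unfolding orthogonal_transformation_def
  using linear_compose[OF linear_from_coords[of e] linear_to_coords[of f]] assms
  by (simp add: o_def to_coords_inner from_coords_inner_from_coords)

text \<open>Passing from \<open>b\<close> to \<open>e\<close> in the source and to \<open>f\<close>
  in the target multiplies the matrix by orthogonal matrices, of determinant 1 or -1, and makes it
  upper triangular. The two changes of basis are independent, so only the absolute value
  survives.\<close>

lemma det_triangular_bases:
  fixes D :: "'a::euclidean_space \<Rightarrow> 'a"
  assumes lin: "linear D" and on: "onb b" "onb e" "onb f"
    and tri: "\<And>i j. i < DIM('a) \<Longrightarrow> j < i \<Longrightarrow> D (e j) \<bullet> f i = 0"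
  shows "\<bar>Determinants.det (matrix (\<lambda>z. to_coords b (D (from_coords b z))))\<bar> = (\<Prod>i<DIM('a). \<bar>D (e i) \<bullet> f i\<bar>)"
proof -
  let ?M = "\<lambda>z. to_coords b (D (from_coords b z))"
  let ?R = "\<lambda>z. to_coords f (D (from_coords e z))"
  let ?P = "\<lambda>z. to_coords f (from_coords b z)" and ?Q = "\<lambda>z. to_coords b (from_coords e z)"
  have P: "orthogonal_transformation ?P" and Q: "orthogonal_transformation ?Q"
    using on by (auto intro: orthogonal_change_of_coords)
  then have lP: "linear ?P" and lQ: "linear ?Q" by (auto intro: orthogonal_transformation_linear)
  have lM: "linear ?M"
    using linear_compose[OF linear_compose[OF linear_from_coords lin] linear_to_coords] by (simp add: o_def)
  have R: "?R = ?P \<circ> (?M \<circ> ?Q)"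
    using on by (simp add: fun_eq_iff from_to_coords)
  have "matrix ?R = matrix ?P ** (matrix ?M ** matrix ?Q)"
    unfolding R by (simp only: matrix_compose[OF linear_compose[OF lQ lM] lP] matrix_compose[OF lQ lM])
  then have "\<bar>Determinants.det (matrix ?R)\<bar> = \<bar>Determinants.det (matrix ?M)\<bar>"
    using orthogonal_transformation_det[OF P] orthogonal_transformation_det[OF Q]
    by (simp add: det_mul abs_mult)
  moreover have entry: "matrix ?R $ i $ j = D (e (Rep_coord j)) \<bullet> f (Rep_coord i)" for i j
  proof -
    have "from_coords e (axis j 1) = e (Rep_coord j)"
      unfolding from_coords_def axis_def by (simp add: if_distrib[of "\<lambda>x. x *\<^sub>R _"] cong: if_cong)
    then show ?thesis by (simp add: matrix_def to_coords_def)
  qed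
  have "Determinants.det (matrix ?R) = (\<Prod>i\<in>UNIV. matrix ?R $ i $ i)"
    by (rule det_upperdiagonal) (use tri Rep_coord_less in \<open>auto simp: entry less_coord_def\<close>)
  then have "\<bar>Determinants.det (matrix ?R)\<bar> = (\<Prod>i\<in>UNIV. \<bar>D (e (Rep_coord (i :: 'a coord))) \<bullet> f (Rep_coord i)\<bar>)"
    by (simp add: entry abs_prod)
  also have "\<dots> = (\<Prod>i<DIM('a). \<bar>D (e i) \<bullet> f i\<bar>)"
    by (rule prod.reindex_bij_betw[OF bij_betw_Rep_coord])
  ultimately show ?thesis by simp
qed

section \<open>Lebesgue measure in standard coordinates\<close>

lemma ex_onb_Basis:
  obtains b :: "nat \<Rightarrow> 'a::euclidean_space" where "onb b" "bij_betw b {..<DIM('a)} Basis"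
proof -
  obtain b where b: "bij_betw b {0..<DIM('a)} (Basis :: 'a set)"
    using ex_bij_betw_nat_finite[OF finite_Basis] by blast
  then have "b i \<in> Basis" "b j \<in> Basis" "b i = b j \<longleftrightarrow> i = j" if "i < DIM('a)" "j < DIM('a)" for i j
    using that by (auto simp: bij_betw_def inj_on_def)
  then have "onb b" by (simp add: onb_def inner_Basis)
  then show ?thesis using that b by (simp add: atLeast0LessThan)
qed

text \<open>Lebesgue measure is determined by its values on boxes. As \<open>b\<close> enumerates
  \<open>Basis\<close>, the preimage of a box is a box with the same side lengths, which in general
  fails for other orthonormal bases.\<close>

lemma lborel_distr_from_coords:
  fixes b :: "nat \<Rightarrow> 'a::euclidean_space"
  assumes b: "onb b" "bij_betw b {..<DIM('a)} Basis"
  shows "distr lborel borel (from_coords b) = lborel"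
proof (rule lborel_eqI[symmetric])
  have bb: "bij_betw (\<lambda>i :: 'a coord. b (Rep_coord i)) UNIV (Basis :: 'a set)"
    using bij_betw_trans[OF bij_betw_Rep_coord b(2)] by (simp add: o_def)
  then have rng: "Basis = range (\<lambda>i :: 'a coord. b (Rep_coord i))" by (simp add: bij_betw_def)
  then have bas: "b (Rep_coord i) \<in> Basis" for i :: "'a coord" by (auto simp: bij_betw_def)
  have meas: "from_coords b \<in> borel_measurable lborel"
    using linear_continuous_on[of "from_coords b" UNIV] linear_from_coords[of b]
    by (simp add: borel_measurable_continuous_onI linear_conv_bounded_linear)
  fix l u :: 'a
  assume lu: "\<And>c. c \<in> Basis \<Longrightarrow> l \<bullet> c \<le> u \<bullet> c"
  have ax: "Basis = range (\<lambda>i::'a coord. axis i (1::real))"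
    by (auto simp: Basis_vec_def)
  have "from_coords b z \<in> box l u \<longleftrightarrow> z \<in> box (to_coords b l) (to_coords b u)" for z
  proof -
    have "from_coords b z \<in> box l u \<longleftrightarrow> (\<forall>i::'a coord. l \<bullet> b (Rep_coord i) < from_coords b z \<bullet> b (Rep_coord i) \<and>
        from_coords b z \<bullet> b (Rep_coord i) < u \<bullet> b (Rep_coord i))"
      unfolding mem_box rng by blast
    also have "\<dots> \<longleftrightarrow> z \<in> box (to_coords b l) (to_coords b u)"
      by (simp add: mem_box_cart from_coords_inner[OF b(1)] to_coords_def)
    finally show ?thesis .
  qed
  then have vi: "from_coords b -` box l u = box (to_coords b l) (to_coords b u)" by auto
  have "emeasure (distr lborel borel (from_coords b)) (box l u) = emeasure lborel (box (to_coords b l) (to_coords b u))"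
    using meas by (simp add: emeasure_distr vi)
  also have "\<dots> = ennreal (\<Prod>c\<in>Basis. (to_coords b u - to_coords b l) \<bullet> c)"
    using lu bas by (subst emeasure_lborel_box) (auto simp: ax inner_axis to_coords_def)
  also have "(\<Prod>c\<in>Basis. (to_coords b u - to_coords b l) \<bullet> c) = (\<Prod>i\<in>UNIV. (to_coords b u - to_coords b l) \<bullet> axis i 1)"
    unfolding ax by (subst prod.reindex) (auto simp: inj_on_def axis_eq_axis)
  also have "\<dots> = (\<Prod>i\<in>UNIV. (u - l) \<bullet> b (Rep_coord (i :: 'a coord)))"
    by (simp add: inner_axis to_coords_def inner_diff_left)
  also have "\<dots> = (\<Prod>c\<in>Basis. (u - l) \<bullet> c)"
    by (rule prod.reindex_bij_betw[OF bb])
  finally show "emeasure (distr lborel borel (from_coords b)) (box l u) = (\<Prod>c\<in>Basis. (u - l) \<bullet> c)" .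
qed simp

section \<open>Derivatives of fields on the sphere\<close>

lemma continuous_on_locally:
  fixes f :: "'a::t2_space \<Rightarrow> 'b::topological_space"
  assumes "\<And>x. x \<in> S \<Longrightarrow> \<exists>U. open U \<and> x \<in> U \<and> continuous_on (U \<inter> S) f"
  shows "continuous_on S f"
  unfolding continuous_on_eq_continuous_within
proof
  fix x assume x: "x \<in> S"
  then obtain U where U: "open U" "x \<in> U" "continuous_on (U \<inter> S) f" using assms by blast
  then have "continuous (at x within U \<inter> S) f"
    using x by (simp add: continuous_on_eq_continuous_within)
  moreover have "at x within U \<inter> S = at x within S"
    by (rule at_within_nhd[OF U(2,1)]) auto
  ultimately show "continuous (at x within S) f" by simp
qed

lemma smooth_on_sphere_continuous:
  assumes "smooth_on_sphere v"
  shows "continuous_on (sphere 0 1) v"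
proof (rule continuous_on_locally)
  fix x :: 'a assume "x \<in> sphere 0 1"
  then obtain U g where U: "open U" "x \<in> U" "smooth_on U g" "\<forall>y\<in>U \<inter> sphere 0 1. g y = v y"
    using assms unfolding smooth_on_sphere_def by blast
  have "Ck_on 0 U g" using U(3) by (simp only: smooth_on_def)
  then have "continuous_on (U \<inter> sphere 0 1) g" by (auto intro: continuous_on_subset)
  then have "continuous_on (U \<inter> sphere 0 1) v" by (rule continuous_on_eq) (use U(4) in blast)
  then show "\<exists>U. open U \<and> x \<in> U \<and> continuous_on (U \<inter> sphere 0 1) v" using U by blast
qed

lemma linear_sphere_deriv:
  assumes "smooth_on_sphere v" "x \<in> sphere 0 1"
  shows "linear (sphere_deriv v x)"
  using sphere_deriv_works[OF assms] by (rule has_derivative_linear)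

text \<open>The extension used by \<open>sphere_deriv\<close> is constant along rays, so the radial
  part of \<open>h\<close> drops out, and any smooth local extension \<open>g\<close> computes the
  rest.\<close>

lemma sphere_deriv_tangential_part:
  assumes "smooth_on_sphere v" "x \<in> sphere 0 1" "open U" "x \<in> U" "smooth_on U g" "\<forall>y\<in>U \<inter> sphere 0 1. g y = v y"
  shows "sphere_deriv v x h = frechet_derivative g (at x) (h - (h \<bullet> x) *\<^sub>R x)"
proof -
  have "(g has_derivative frechet_derivative g (at x)) (at x)"
    using smooth_on_imp_differentiable[OF assms(5,4)] frechet_derivative_works by blast
  from extension_has_derivative[OF assms(2,3,4,6) this]
  have "sphere_deriv v x = (\<lambda>h. frechet_derivative g (at x) (h - (h \<bullet> x) *\<^sub>R x))"
    by (rule has_derivative_unique[OF sphere_deriv_works[OF assms(1,2)]])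
  then show ?thesis by simp
qed

lemma sphere_deriv_radial:
  assumes "smooth_on_sphere v" "x \<in> sphere 0 1"
  shows "sphere_deriv v x x = 0"
proof -
  obtain U g where U: "open U" "x \<in> U" "smooth_on U g" "\<forall>y\<in>U \<inter> sphere 0 1. g y = v y"
    using assms unfolding smooth_on_sphere_def by blast
  have "linear (frechet_derivative g (at x))"
    using smooth_on_imp_differentiable[OF U(3,2)] by (rule linear_frechet_derivative)
  moreover have "x \<bullet> x = 1" using assms(2) by (simp add: norm_eq_1)
  ultimately show ?thesis
    unfolding sphere_deriv_tangential_part[OF assms U] by (simp add: linear_0)
qed

lemma continuous_on_sphere_deriv:
  fixes v :: "'a::euclidean_space \<Rightarrow> 'b::real_normed_vector"
  assumes "smooth_on_sphere v"
  shows "continuous_on (sphere 0 1) (\<lambda>x. sphere_deriv v x h)"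
proof (rule continuous_on_locally)
  fix x :: 'a assume "x \<in> sphere 0 1"
  then obtain U g where U: "open U" "x \<in> U" "smooth_on U g" "\<forall>y\<in>U \<inter> sphere 0 1. g y = v y"
    using assms unfolding smooth_on_sphere_def by blast
  have "Ck_on (Suc 0) U g" using U(3) by (simp only: smooth_on_def)
  then have c: "continuous_on (U \<inter> sphere 0 1) (\<lambda>y. frechet_derivative g (at y) k)" for k
    by (auto intro: continuous_on_subset)
  have lin: "linear (frechet_derivative g (at y))" if "y \<in> U" for y
    using smooth_on_imp_differentiable[OF U(3) that] by (rule linear_frechet_derivative)
  \<comment> \<open>\<open>Ck_on\<close> yields continuity of the derivative of \<open>g\<close> in
    a fixed direction. The tangential part of \<open>h\<close> varies with \<open>y\<close>, so the
    derivative in the direction \<open>y\<close> is expanded over \<open>Basis\<close>.\<close>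
  let ?G = "\<lambda>y. frechet_derivative g (at y) h - (h \<bullet> y) *\<^sub>R (\<Sum>b\<in>Basis. (y \<bullet> b) *\<^sub>R frechet_derivative g (at y) b)"
  have "continuous_on (U \<inter> sphere 0 1) ?G"
    by (intro continuous_intros c)
  moreover have "?G y = sphere_deriv v y h" if y: "y \<in> U \<inter> sphere 0 1" for y
  proof -
    have yU: "y \<in> U" "y \<in> sphere 0 1" using y by auto
    have "frechet_derivative g (at y) y = frechet_derivative g (at y) (\<Sum>b\<in>Basis. (y \<bullet> b) *\<^sub>R b)"
      by (simp add: euclidean_representation)
    also have "\<dots> = (\<Sum>b\<in>Basis. (y \<bullet> b) *\<^sub>R frechet_derivative g (at y) b)"
      using lin[OF yU(1)] by (simp add: linear_sum linear_scale)
    finally show ?thesis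
      unfolding sphere_deriv_tangential_part[OF assms yU(2) U(1) yU(1) U(3,4)]
      using lin[OF yU(1)] by (simp add: linear_diff linear_scale)
  qed
  ultimately have "continuous_on (U \<inter> sphere 0 1) (\<lambda>y. sphere_deriv v y h)"
    by (rule continuous_on_eq)
  then show "\<exists>U. open U \<and> x \<in> U \<and> continuous_on (U \<inter> sphere 0 1) (\<lambda>x. sphere_deriv v x h)"
    using U by blast
qed

text \<open>Compactness of the sphere bounds the derivative in each basis direction, and linearity
  combines these bounds into one that is uniform in \<open>x\<close>.\<close>

lemma sphere_deriv_bounded:
  fixes v :: "'a::euclidean_space \<Rightarrow> 'b::real_normed_vector"
  assumes "smooth_on_sphere v"
  obtains L where "0 \<le> L" "\<And>x h. x \<in> sphere 0 1 \<Longrightarrow> norm (sphere_deriv v x h) \<le> L * norm h"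
proof -
  have "\<exists>B. \<forall>x\<in>sphere 0 1. norm (sphere_deriv v x b) \<le> B" for b
    using compact_imp_bounded[OF compact_continuous_image[OF continuous_on_sphere_deriv[OF assms, of b] compact_sphere]]
    by (auto simp: bounded_iff)
  then obtain B where B: "\<And>b x. x \<in> sphere 0 1 \<Longrightarrow> norm (sphere_deriv v x b) \<le> B b" by metis
  have "norm (sphere_deriv v x h) \<le> (\<Sum>b\<in>Basis. \<bar>B b\<bar>) * norm h" if x: "x \<in> sphere 0 1" for x h
  proof -
    have lin: "linear (sphere_deriv v x)" using assms x by (rule linear_sphere_deriv)
    have "sphere_deriv v x h = sphere_deriv v x (\<Sum>b\<in>Basis. (h \<bullet> b) *\<^sub>R b)"
      by (simp add: euclidean_representation)
    also have "\<dots> = (\<Sum>b\<in>Basis. (h \<bullet> b) *\<^sub>R sphere_deriv v x b)"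
      using lin by (simp add: linear_sum linear_scale)
    also have "norm \<dots> \<le> (\<Sum>b\<in>Basis. \<bar>B b\<bar> * norm h)"
    proof (rule sum_norm_le)
      fix b :: 'a assume "b \<in> Basis"
      then have "\<bar>h \<bullet> b\<bar> \<le> norm h" by (rule Basis_le_norm)
      moreover have "norm (sphere_deriv v x b) \<le> \<bar>B b\<bar>" using B[OF x, of b] by linarith
      ultimately have "\<bar>h \<bullet> b\<bar> * norm (sphere_deriv v x b) \<le> norm h * \<bar>B b\<bar>"
        by (intro mult_mono) auto
      then show "norm ((h \<bullet> b) *\<^sub>R sphere_deriv v x b) \<le> \<bar>B b\<bar> * norm h" by (simp add: mult.commute)
    qed
    finally show ?thesis by (simp only: sum_distrib_right)
  qed
  then show ?thesis using that[of "\<Sum>b\<in>Basis. \<bar>B b\<bar>"] by (simp add: sum_nonneg)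
qed

text \<open>Both sides vanish for \<open>h = x\<close>, so the formula for tangent directions
  extends by linearity.\<close>

lemma sphere_deriv_normal:
  fixes v :: "'a::euclidean_space \<Rightarrow> 'a"
  assumes "smooth_tangent_field v" "x \<in> sphere 0 1"
  shows "sphere_deriv v x h \<bullet> x = - (v x \<bullet> h)"
proof -
  have sm: "smooth_on_sphere v" and vx: "v x \<bullet> x = 0"
    using assms by (auto simp: smooth_tangent_field_def tangent_space_def)
  let ?t = "h - (h \<bullet> x) *\<^sub>R x"
  have "x \<bullet> x = 1" using assms(2) by (simp add: norm_eq_1)
  then have "?t \<in> tangent_space x" by (simp add: tangent_space_def inner_diff_left)
  then have "sphere_deriv v x ?t \<bullet> x = - (v x \<bullet> ?t)"
    by (rule sphere_deriv_normal_part[OF assms])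
  moreover have "sphere_deriv v x ?t = sphere_deriv v x h"
    using linear_sphere_deriv[OF sm assms(2)] sphere_deriv_radial[OF sm assms(2)]
    by (simp add: linear_diff linear_scale)
  ultimately show ?thesis using vx by (simp add: inner_diff_right)
qed

text \<open>Differentiate \<open>v \<bullet> v = 1\<close>, which holds for the radially constant
  extension away from the origin.\<close>

lemma sphere_deriv_orthogonal_unit_field:
  fixes v :: "'a::euclidean_space \<Rightarrow> 'a"
  assumes "smooth_unit_field v" "x \<in> sphere 0 1"
  shows "sphere_deriv v x h \<bullet> v x = 0"
proof -
  have D: "((\<lambda>y. v (y /\<^sub>R norm y)) has_derivative sphere_deriv v x) (at x)"
    using assms by (intro sphere_deriv_works) (auto simp: smooth_unit_field_def smooth_tangent_field_def)
  have nx: "norm x = 1" using assms(2) by simp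
  have one: "v (y /\<^sub>R norm y) \<bullet> v (y /\<^sub>R norm y) = 1" if "y \<noteq> 0" for y
  proof -
    have "y /\<^sub>R norm y \<in> sphere 0 1" using that by simp
    then have "norm (v (y /\<^sub>R norm y)) = 1" using assms(1) unfolding smooth_unit_field_def by blast
    then show ?thesis by (simp add: norm_eq_1)
  qed
  have "((\<lambda>y. 1 :: real) has_derivative
      (\<lambda>h. v (x /\<^sub>R norm x) \<bullet> sphere_deriv v x h + sphere_deriv v x h \<bullet> v (x /\<^sub>R norm x))) (at x)"
  proof (rule has_derivative_transform_within_open[OF has_derivative_inner[OF D D], of "- {0}"])
    show "x \<in> - {0}" using nx by auto
    show "v (y /\<^sub>R norm y) \<bullet> v (y /\<^sub>R norm y) = 1" if "y \<in> - {0}" for y using one that by simp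
  qed auto
  then have "(\<lambda>h. v (x /\<^sub>R norm x) \<bullet> sphere_deriv v x h + sphere_deriv v x h \<bullet> v (x /\<^sub>R norm x)) = (\<lambda>h. 0)"
    by (rule has_derivative_unique) simp
  from fun_cong[OF this, of h] show ?thesis using nx by (simp add: inner_commute[of "v x"])
qed

text \<open>Product rule for the norm and the radially constant extension. The derivative of the
  latter at \<open>y\<close> is \<open>1 / norm y\<close> times that at the normalized point, and
  the factor \<open>norm y\<close> cancels this. Hence the Jacobian depends only on the direction of
  \<open>y\<close>, so it can be compared with a function on the sphere.\<close>

lemma homogeneous_extension_has_derivative:
  fixes v :: "'a::euclidean_space \<Rightarrow> 'a"
  assumes "smooth_on_sphere v" "y \<noteq> 0"
  shows "((\<lambda>z. norm z *\<^sub>R v (z /\<^sub>R norm z)) has_derivative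
     (\<lambda>h. (h \<bullet> (y /\<^sub>R norm y)) *\<^sub>R v (y /\<^sub>R norm y) + sphere_deriv v (y /\<^sub>R norm y) h)) (at y)"
proof -
  define c where "c = inverse (norm y)"
  have c: "c > 0" using assms(2) by (simp add: c_def)
  define x where "x = c *\<^sub>R y"
  have x: "x \<in> sphere 0 1" using assms(2) by (simp add: x_def c_def)
  have lin: "linear (sphere_deriv v x)" using assms(1) x by (rule linear_sphere_deriv)
  have "((\<lambda>z. v ((c *\<^sub>R z) /\<^sub>R norm (c *\<^sub>R z))) has_derivative (\<lambda>h. sphere_deriv v x (c *\<^sub>R h))) (at y)"
  proof (rule has_derivative_compose[of "\<lambda>z. c *\<^sub>R z" "\<lambda>h. c *\<^sub>R h" y UNIV "\<lambda>z. v (z /\<^sub>R norm z)" "sphere_deriv v x"])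
    show "((\<lambda>z. v (z /\<^sub>R norm z)) has_derivative sphere_deriv v x) (at (c *\<^sub>R y))"
      using sphere_deriv_works[OF assms(1) x] by (simp add: x_def)
  qed (intro has_derivative_scaleR_right has_derivative_ident)
  moreover have "(c *\<^sub>R z) /\<^sub>R norm (c *\<^sub>R z) = z /\<^sub>R norm z" for z :: 'a
    using c by (simp add: mult.commute)
  ultimately have D: "((\<lambda>z. v (z /\<^sub>R norm z)) has_derivative (\<lambda>h. c *\<^sub>R sphere_deriv v x h)) (at y)"
    by (simp only: linear_scale[OF lin])
  have N: "(norm has_derivative (\<lambda>h. h \<bullet> sgn y)) (at y)"
    using assms(2) by (rule has_derivative_norm)
  have "((\<lambda>z. norm z *\<^sub>R v (z /\<^sub>R norm z)) has_derivative
     (\<lambda>h. norm y *\<^sub>R (c *\<^sub>R sphere_deriv v x h) + (h \<bullet> sgn y) *\<^sub>R v (y /\<^sub>R norm y))) (at y)"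
    by (rule has_derivative_scaleR[OF N D])
  moreover have "norm y *\<^sub>R (c *\<^sub>R k) = k" for k :: 'a using assms(2) by (simp add: c_def)
  ultimately show ?thesis
    by (simp add: sgn_div_norm x_def c_def add.commute)
qed

section \<open>Comparison of the functionals\<close>

lemma integral_scale_measure:
  fixes f :: "'a \<Rightarrow> real"
  assumes "f \<in> borel_measurable M" "0 \<le> c"
  shows "integral\<^sup>L (scale_measure (ennreal c) M) f = c * integral\<^sup>L M f"
proof -
  have "scale_measure (ennreal c) M = density M (\<lambda>_. ennreal c)"
    by (rule measure_eqI) (auto simp: emeasure_density nn_integral_cmult_indicator)
  then show ?thesis using assms by (simp add: integral_density)
qed

text \<open>\<open>sphere_measure\<close> is the image of a multiple of Lebesgue measure under
  normalization, so the integral is by construction one of the radially constant extension over the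
  punctured ball; \<open>lborel_distr_from_coords\<close> carries it to coordinates. Compactness of
  the sphere bounds \<open>f\<close> and gives integrability.\<close>

lemma sphere_measure_integral:
  fixes f :: "'a::euclidean_space \<Rightarrow> real"
  assumes cont: "continuous_on (sphere 0 1) f" and b: "onb b" "bij_betw b {..<DIM('a)} Basis"
  shows "(\<lambda>z. f (from_coords b z /\<^sub>R norm z)) integrable_on (ball 0 1 - {0})"
    and "(\<integral>x. f x \<partial>sphere_measure) = DIM('a) * integral (ball 0 1 - {0}) (\<lambda>z. f (from_coords b z /\<^sub>R norm z))"
proof -
  let ?S = "ball 0 1 - {0} :: 'a set" and ?S' = "ball 0 1 - {0} :: (real^'a coord) set"
  let ?R = "restrict_space lborel ?S"
  define g where "g = (\<lambda>x::'a. f (x /\<^sub>R norm x))"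
  have gS: "g (from_coords b z) = f (from_coords b z /\<^sub>R norm z)" for z
    by (simp add: g_def norm_from_coords[OF b(1)])
  have f: "f \<in> borel_measurable (restrict_space borel (sphere 0 1))"
    using cont by (rule borel_measurable_continuous_on_restrict)
  have n: "(\<lambda>x::'a. x /\<^sub>R norm x) \<in> scale_measure (of_nat DIM('a)) ?R \<rightarrow>\<^sub>M restrict_space borel (sphere 0 1)"
    using measurable_normalize measurable_cong_sets[OF sets_scale_measure refl] by blast
  have gR: "g \<in> borel_measurable ?R"
    unfolding g_def by (rule measurable_compose[OF measurable_normalize f])
  then have gm: "(\<lambda>x. indicator ?S x *\<^sub>R g x) \<in> borel_measurable lborel"
    by (subst (asm) borel_measurable_restrict_space_iff) auto
  have fc: "from_coords b \<in> borel_measurable lborel"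
    using linear_continuous_on[of "from_coords b" UNIV] linear_from_coords[of b]
    by (simp add: borel_measurable_continuous_onI linear_conv_bounded_linear)
  have ind: "indicator ?S (from_coords b z) = (indicator ?S' z :: real)" for z
  proof -
    have "norm (from_coords b z) = norm z" by (rule norm_from_coords[OF b(1)])
    then have "from_coords b z = 0 \<longleftrightarrow> z = 0" "norm (from_coords b z) < 1 \<longleftrightarrow> norm z < 1"
      by (metis norm_eq_zero, simp)
    then have "from_coords b z \<in> ?S \<longleftrightarrow> z \<in> ?S'" by simp
    then show ?thesis by (simp add: indicator_def)
  qed
  have m': "(\<lambda>z. indicator ?S' z *\<^sub>R g (from_coords b z)) \<in> borel_measurable lborel"
    using measurable_compose[OF fc, of "\<lambda>x. indicator ?S x *\<^sub>R g x" borel] gm by (simp add: ind)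
  have "bounded (f ` sphere 0 1)"
    by (rule compact_imp_bounded[OF compact_continuous_image[OF cont compact_sphere]])
  then obtain B where "\<forall>y\<in>f ` sphere 0 1. norm y \<le> B" unfolding bounded_iff by (rule exE)
  then have B: "\<bar>f x\<bar> \<le> B" if "x \<in> sphere 0 1" for x using that by simp
  have "integrable lborel (\<lambda>z. indicator ?S' z *\<^sub>R g (from_coords b z))"
  proof (rule integrableI_bounded_set[where A = "?S'" and B = B])
    show "emeasure lborel ?S' < \<infinity>"
      by (rule le_less_trans[OF emeasure_mono[of _ "ball 0 1"]]) (auto simp: emeasure_ball)
    have "\<bar>g (from_coords b z)\<bar> \<le> B" if "z \<in> ?S'" for z
    proof -
      have "from_coords b z /\<^sub>R norm z \<in> sphere 0 1" using that by (simp add: norm_from_coords[OF b(1)])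
      then show ?thesis unfolding gS by (rule B)
    qed
    then show "AE z in lborel. z \<in> ?S' \<longrightarrow> norm (indicator ?S' z *\<^sub>R g (from_coords b z)) \<le> B"
      by (intro AE_I2) simp
  qed (use m' in auto)
  then have si: "set_integrable lborel ?S' (\<lambda>z. g (from_coords b z))"
    by (simp add: set_integrable_def)
  show "(\<lambda>z. f (from_coords b z /\<^sub>R norm z)) integrable_on ?S'"
    using set_borel_integral_eq_integral(1)[OF si] by (simp add: gS)
  have "(\<integral>x. f x \<partial>sphere_measure) = integral\<^sup>L (scale_measure (of_nat DIM('a)) ?R) g"
    unfolding sphere_measure_def g_def by (rule integral_distr[OF n f])
  also have "\<dots> = DIM('a) * integral\<^sup>L ?R g"
    using integral_scale_measure[OF gR, of "real DIM('a)"] by (simp add: ennreal_of_nat_eq_real_of_nat)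
  also have "integral\<^sup>L ?R g = integral\<^sup>L lborel (\<lambda>x. indicator ?S x *\<^sub>R g x)"
    by (rule integral_restrict_space) auto
  also have "\<dots> = integral\<^sup>L (distr lborel borel (from_coords b)) (\<lambda>x. indicator ?S x *\<^sub>R g x)"
    by (simp only: lborel_distr_from_coords[OF b])
  also have "\<dots> = integral\<^sup>L lborel (\<lambda>z. indicator ?S' z *\<^sub>R g (from_coords b z))"
    using fc gm by (subst integral_distr) (simp_all add: ind)
  also have "\<dots> = integral ?S' (\<lambda>z. g (from_coords b z))"
    using set_borel_integral_eq_integral(2)[OF si] by (simp add: set_lebesgue_integral_def)
  finally show "(\<integral>x. f x \<partial>sphere_measure) = DIM('a) * integral ?S' (\<lambda>z. f (from_coords b z /\<^sub>R norm z))"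
    by (simp only: gS)
qed

section \<open>The covariant derivative of a unit field and the pointwise inequality\<close>

text \<open>Tangency fixes the normal part of the ambient derivative and unit length its part along
  \<open>v x\<close>. Together these facts put \<open>nabla v x\<close> in the position of
  \<open>T\<close> in \<open>minor_sum_ge_det\<close>.\<close>

lemma nabla_unit_field:
  fixes v :: "'a::euclidean_space \<Rightarrow> 'a"
  assumes v: "smooth_unit_field v" and x: "x \<in> sphere 0 1"
  shows nabla_eq: "nabla v x h = sphere_deriv v x h + (h \<bullet> v x) *\<^sub>R x"
    and linear_nabla: "linear (nabla v x)"
    and nabla_radial: "nabla v x x = 0"
    and nabla_normal: "nabla v x h \<bullet> x = 0"
    and nabla_orthogonal: "nabla v x h \<bullet> v x = 0"
proof -
  have t: "smooth_tangent_field v" and s: "smooth_on_sphere v" and vx: "v x \<bullet> x = 0"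
    using v x by (auto simp: smooth_unit_field_def smooth_tangent_field_def tangent_space_def)
  have xx: "x \<bullet> x = 1" using x by (simp add: norm_eq_1)
  show eq: "nabla v x h = sphere_deriv v x h + (h \<bullet> v x) *\<^sub>R x" for h
    unfolding nabla_def sphere_deriv_normal[OF t x] by (simp add: inner_commute[of "v x"])
  have lin: "linear (sphere_deriv v x)" using s x by (rule linear_sphere_deriv)
  show "linear (nabla v x)"
    by (intro linearI) (simp_all add: eq linear_add[OF lin] linear_scale[OF lin] inner_add_left scaleR_add_left scaleR_add_right)
  show "nabla v x x = 0"
    by (simp add: nabla_def sphere_deriv_radial[OF s x])
  show "nabla v x h \<bullet> x = 0"
    by (simp add: nabla_def inner_diff_left xx)
  show "nabla v x h \<bullet> v x = 0"
    using sphere_deriv_orthogonal_unit_field[OF v x] vx by (simp add: eq inner_add_left inner_commute[of x])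
qed

text \<open>The frame chosen in \<open>wedge_norm2\<close> need not depend continuously on the
  point. A fixed basis of the ambient space expresses the same quantity as a polynomial in
  continuous entries.\<close>

lemma continuous_on_wedge_norm2:
  fixes v :: "'a::euclidean_space \<Rightarrow> 'a"
  assumes v: "smooth_unit_field v" and b: "onb (b :: nat \<Rightarrow> 'a)"
  shows "continuous_on (sphere 0 1) (wedge_norm2 k v)"
proof (rule continuous_on_eq)
  have s: "smooth_on_sphere v"
    using v by (auto simp: smooth_unit_field_def smooth_tangent_field_def)
  have "continuous_on (sphere 0 1) (\<lambda>x. nabla v x h)" for h
    unfolding nabla_def by (intro continuous_intros continuous_on_sphere_deriv[OF s])
  then show "continuous_on (sphere 0 1) (\<lambda>x. minor_sum k DIM('a) (\<lambda>i j. nabla v x (b j) \<bullet> b i))"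
    unfolding minor_sum_def det_mat_leibniz by (intro continuous_intros)
  show "minor_sum k DIM('a) (\<lambda>i j. nabla v x (b j) \<bullet> b i) = wedge_norm2 k v x" if x: "x \<in> sphere 0 1" for x
    using wedge_norm2_eq_minor_sum[OF x linear_nabla[OF v x] nabla_radial[OF v x] nabla_normal[OF v x] b b] by simp
qed

text \<open>The map inside the determinant is the derivative at \<open>x\<close> of the
  1-homogeneous extension of \<open>v\<close>, in the coordinates of \<open>b\<close>. It is
  triangular in the bases from \<open>minor_sum_ge_det\<close>, so its determinant is up to sign the
  product bounded there.\<close>

lemma wedge_norm2_ge_det:
  fixes v :: "'a::euclidean_space \<Rightarrow> 'a"
  assumes DIM: "DIM('a) = 2 * n + 2" and v: "smooth_unit_field v" and x: "x \<in> sphere 0 1" and b: "onb b"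
  shows "real (2 * n choose n) * \<bar>Determinants.det (matrix (\<lambda>z. to_coords b
     ((from_coords b z \<bullet> x) *\<^sub>R v x + sphere_deriv v x (from_coords b z))))\<bar> \<le> wedge_norm2 n v x"
proof -
  define D where "D = (\<lambda>h. (h \<bullet> x) *\<^sub>R v x + sphere_deriv v x h)"
  have xv: "norm x = 1" "norm (v x) = 1" "v x \<bullet> x = 0"
    using v x by (auto simp: smooth_unit_field_def smooth_tangent_field_def tangent_space_def)
  have D: "D h = (h \<bullet> x) *\<^sub>R v x + nabla v x h - (h \<bullet> v x) *\<^sub>R x" for h
    by (simp add: D_def nabla_eq[OF v x])
  have lin: "linear (sphere_deriv v x)"
    using v x by (intro linear_sphere_deriv) (auto simp: smooth_unit_field_def smooth_tangent_field_def)
  have lD: "linear D"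
    unfolding D_def by (intro linearI) (simp_all add: linear_add[OF lin] linear_scale[OF lin] inner_add_left scaleR_add_left scaleR_add_right)
  obtain e f where ef: "onb e" "onb f" "\<And>i j. i < DIM('a) \<Longrightarrow> j < i \<Longrightarrow> D (e j) \<bullet> f i = 0"
    "real (2 * n choose n) * (\<Prod>i<DIM('a). \<bar>D (e i) \<bullet> f i\<bar>) \<le> minor_sum n DIM('a) (\<lambda>i j. nabla v x (e j) \<bullet> f i)"
    using minor_sum_ge_det[OF DIM xv nabla_radial[OF v x] nabla_normal[OF v x] nabla_orthogonal[OF v x] D]
    by blast
  have "minor_sum n DIM('a) (\<lambda>i j. nabla v x (e j) \<bullet> f i) = wedge_norm2 n v x"
    using wedge_norm2_eq_minor_sum[OF x linear_nabla[OF v x] nabla_radial[OF v x] nabla_normal[OF v x] ef(1,2)] by simp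
  then show ?thesis
    using ef(4) det_triangular_bases[OF lD b ef(1,2,3)] by (simp add: D_def)
qed

lemma integral_det_unit_field:
  fixes v :: "'a::euclidean_space \<Rightarrow> 'a"
  assumes DIM: "DIM('a) = 2 * m" and v: "smooth_unit_field v" and b: "onb (b :: nat \<Rightarrow> 'a)"
  shows "((\<lambda>z. Determinants.det (matrix (\<lambda>h. to_coords b
     ((from_coords b h \<bullet> (from_coords b z /\<^sub>R norm z)) *\<^sub>R v (from_coords b z /\<^sub>R norm z) +
        sphere_deriv v (from_coords b z /\<^sub>R norm z) (from_coords b h))))) has_integral unit_ball_vol (2 * m)) (ball 0 1 - {0})"
proof -
  define r where "r = (\<lambda>z. from_coords b z /\<^sub>R norm z)"
  define w' where "w' = (\<lambda>z h. to_coords b ((from_coords b h \<bullet> r z) *\<^sub>R v (r z) + sphere_deriv v (r z) (from_coords b h)))"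
  \<comment> \<open>The 1-homogeneous extension in coordinates. At the origin the factor
    \<open>norm\<close> makes the value 0, whatever \<open>v 0\<close> is.\<close>
  define w where "w = (\<lambda>z. to_coords b (norm (from_coords b z) *\<^sub>R v (from_coords b z /\<^sub>R norm (from_coords b z))))"
  have s: "smooth_on_sphere v" and vn: "\<And>x. x \<in> sphere 0 1 \<Longrightarrow> norm (v x) = 1" and vt: "\<And>x. x \<in> sphere 0 1 \<Longrightarrow> v x \<bullet> x = 0"
    using v by (auto simp: smooth_unit_field_def smooth_tangent_field_def tangent_space_def)
  have nf: "norm (from_coords b z) = norm z" for z by (rule norm_from_coords[OF b])
  have r: "r z \<in> sphere 0 1" if "z \<noteq> 0" for z using that by (simp add: r_def nf)
  have bl: "bounded_linear (from_coords b)" "bounded_linear (to_coords b)"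
    using linear_from_coords linear_to_coords by (simp_all add: linear_conv_bounded_linear)
  obtain L where L: "0 \<le> L" "\<And>x h. x \<in> sphere 0 1 \<Longrightarrow> norm (sphere_deriv v x h) \<le> L * norm h"
    using sphere_deriv_bounded[OF s] by blast
  have "((\<lambda>z. Determinants.det (matrix (w' z))) has_integral unit_ball_vol (2 * m)) (ball 0 1 - {0})"
  \<comment> \<open>In the bound \<open>1 + L\<close> the 1 accounts for the radial term, a product
    with the unit vectors \<open>r y\<close> and \<open>v (r y)\<close>, and \<open>L\<close> for
    the derivative along the sphere.\<close>
  proof (rule integral_det_homogeneous_field[where w = w and L = "1 + L"])
    show "CARD('a coord) = 2 * m" by (simp add: card_coord DIM)
    show "(w has_derivative w' y) (at y)" if "y \<noteq> 0" for y
    proof -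
      have "from_coords b y \<noteq> 0" using that nf[of y] by (metis norm_eq_zero)
      from homogeneous_extension_has_derivative[OF s this]
      have "((\<lambda>z. norm z *\<^sub>R v (z /\<^sub>R norm z)) has_derivative
        (\<lambda>h. (h \<bullet> r y) *\<^sub>R v (r y) + sphere_deriv v (r y) h)) (at (from_coords b y))"
        by (simp add: r_def nf)
      from has_derivative_compose[OF bounded_linear_imp_has_derivative[OF bl(1)] this]
      show ?thesis unfolding w_def w'_def by (rule bounded_linear.has_derivative[OF bl(2)])
    qed
    show "continuous_on (- {0}) (\<lambda>y. w' y h)" for h
    proof -
      have cr: "continuous_on (- {0}) r"
        unfolding r_def by (intro continuous_intros linear_continuous_on bl) auto
      have im: "r ` (- {0}) \<subseteq> sphere 0 1" by (intro image_subsetI r) simp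
      have "continuous_on (- {0}) (\<lambda>y. v (r y))" "continuous_on (- {0}) (\<lambda>y. sphere_deriv v (r y) k)" for k
        using continuous_on_compose2[OF smooth_on_sphere_continuous[OF s] cr im]
          continuous_on_compose2[OF continuous_on_sphere_deriv[OF s] cr im] by auto
      then show ?thesis
        unfolding w'_def by (intro bounded_linear.continuous_on[OF bl(2)] continuous_intros cr)
    qed
    show "norm (w' y h) \<le> (1 + L) * norm h" if "y \<noteq> 0" for y h
    proof -
      have "norm (w' y h) = norm ((from_coords b h \<bullet> r y) *\<^sub>R v (r y) + sphere_deriv v (r y) (from_coords b h))"
        unfolding w'_def by (rule norm_to_coords[OF b])
      also have "\<dots> \<le> \<bar>from_coords b h \<bullet> r y\<bar> + norm (sphere_deriv v (r y) (from_coords b h))"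
        using norm_triangle_ineq[of "(from_coords b h \<bullet> r y) *\<^sub>R v (r y)"] vn[OF r[OF that]] by simp
      also have "\<bar>from_coords b h \<bullet> r y\<bar> \<le> norm h"
        using Cauchy_Schwarz_ineq2[of "from_coords b h" "r y"] r[OF that] by (simp add: nf)
      also have "norm (sphere_deriv v (r y) (from_coords b h)) \<le> L * norm h"
        using L(2)[OF r[OF that], of "from_coords b h"] by (simp add: nf)
      finally show ?thesis by (simp add: algebra_simps)
    qed
    show "norm (w y) = norm y" for y
    proof (cases "y = 0")
      case False
      then show ?thesis using vn[OF r[OF False]] by (simp add: w_def norm_to_coords[OF b] nf r_def)
    qed (simp add: w_def norm_to_coords[OF b] nf)
    show "w y \<bullet> y = 0" for y
    proof (cases "y = 0")
      case False
      have "w y \<bullet> y = w y \<bullet> to_coords b (from_coords b y)" by (simp add: to_from_coords[OF b])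
      also have "\<dots> = norm y * (v (r y) \<bullet> from_coords b y)"
        unfolding w_def to_coords_inner[OF b] by (simp add: nf r_def)
      also have "from_coords b y = norm y *\<^sub>R r y" using False by (simp add: r_def)
      finally show ?thesis using vt[OF r[OF False]] by simp
    qed simp
  qed
  then show ?thesis by (simp only: w'_def r_def)
qed

text \<open>The rows use the image under \<open>J\<close> of the column basis. Since
  \<open>nabla H x\<close> agrees with \<open>J\<close> on the complement of \<open>x\<close> and
  \<open>H x\<close> and vanishes on these two vectors, its matrix is a truncated identity.\<close>

lemma wedge_norm2_hopf:
  fixes H :: "'a::euclidean_space \<Rightarrow> 'a"
  assumes DIM: "DIM('a) = 2 * n + 2" and H: "hopf_field H" and x: "x \<in> sphere 0 1"
  shows "wedge_norm2 n H x = real (2 * n choose n)"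
proof -
  obtain J where J: "orthogonal_transformation J" "\<And>x. J (J x) = - x" "\<And>x. x \<in> sphere 0 1 \<Longrightarrow> H x = J x"
    using H by (auto simp: hopf_field_def orthogonal_complex_structure_def)
  have lJ: "linear J" using J(1) by (rule orthogonal_transformation_linear)
  have iJ: "J y \<bullet> J z = y \<bullet> z" for y z using J(1) by (simp add: orthogonal_transformation_def)
  have Hu: "smooth_unit_field H" using H by (rule hopf_field_smooth_unit_field)
  have xv: "norm x = 1" "norm (H x) = 1" "H x \<bullet> x = 0"
    using Hu x by (auto simp: smooth_unit_field_def smooth_tangent_field_def tangent_space_def)
  have sd: "sphere_deriv H x h = J (h - (h \<bullet> x) *\<^sub>R x)" for h
  proof -
    have "frechet_derivative J (at x) = J"
      using frechet_derivative_at[OF linear_imp_has_derivative[OF lJ]] by simp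
    then show ?thesis
      using sphere_deriv_tangential_part[of H x UNIV J] Hu x J(3) smooth_on_linear[OF lJ]
      by (simp add: smooth_unit_field_def smooth_tangent_field_def)
  qed
  define m where "m = 2 * n"
  have D2: "DIM('a) = m + 2" using DIM by (simp add: m_def)
  obtain e where e: "onb (e(m := H x, Suc m := x))"
    by (rule orthonormal_pair_basis[OF D2 xv, where u = "\<lambda>_. 0"]) (simp, rule that)
  let ?e = "e(m := H x, Suc m := x)"
  let ?f = "\<lambda>i. J (?e i)"
  have f: "onb ?f" using e by (simp add: onb_def iJ)
  have ex: "e j \<bullet> x = 0" "e j \<bullet> H x = 0" if "j < m" for j
    using e[unfolded onb_def, rule_format, of j m] e[unfolded onb_def, rule_format, of j "Suc m"] D2 that
    by simp_all
  have T: "nabla H x (?e j) = (if j < m then J (e j) else 0)" if "j < DIM('a)" for j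
  proof -
    consider "j < m" | "j = m" | "j = Suc m" using \<open>j < DIM('a)\<close> D2 by linarith
    then show ?thesis
    proof cases
      assume "j < m"
      then show ?thesis by (simp add: nabla_eq[OF Hu x] sd ex)
    next
      \<comment> \<open>Here the ambient derivative in the direction \<open>H x\<close> is
        \<open>J (J x) = - x\<close>, purely normal, and the tangential projection cancels
        it.\<close>
      assume "j = m"
      have "H x \<bullet> H x = 1" using xv(2) by (simp add: norm_eq_1)
      then show ?thesis using \<open>j = m\<close> xv(3) J(2)[of x] J(3)[OF x] by (simp add: nabla_eq[OF Hu x] sd)
    next
      assume "j = Suc m"
      then show ?thesis using nabla_radial[OF Hu x] by simp
    qed
  qed
  have "wedge_norm2 n H x = minor_sum n DIM('a) (\<lambda>i j. nabla H x (?e j) \<bullet> ?f i)"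
    by (rule wedge_norm2_eq_minor_sum[OF x linear_nabla[OF Hu x] nabla_radial[OF Hu x] nabla_normal[OF Hu x] e f])
  also have "\<dots> = minor_sum n (2 * n + 2) (\<lambda>i j. nabla H x (?e j) \<bullet> ?f i)"
    by (simp only: DIM)
  also have "\<dots> = real (2 * n choose n)"
  proof (rule minor_sum_truncated_identity)
    fix i j assume ij: "i < 2 * n + 2" "j < 2 * n + 2"
    have "?e j \<bullet> ?e i = (if j = i then 1 else 0)"
      using e ij unfolding onb_def DIM by blast
    then have "?f j \<bullet> ?f i = (if i = j then 1 else 0)" by (simp only: iJ eq_commute)
    moreover have "nabla H x (?e j) = (if j < m then ?f j else 0)" using T[of j] ij DIM by simp
    ultimately show "nabla H x (?e j) \<bullet> ?f i = (if i = j \<and> i < 2 * n then 1 else 0)"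
      by (cases "i = j") (simp_all only: m_def if_split inner_zero_left, auto)
  qed
  finally show ?thesis .
qed

theorem corollary2:
  fixes H v :: "'a::euclidean_space \<Rightarrow> 'a" and n :: nat
  assumes "n \<ge> 1" and "DIM('a) = 2 * n + 2"
    and "hopf_field H" and "smooth_unit_field v"
  shows "B_functional n H \<le> B_functional n v"
proof -
  note DIM = assms(2) and H = assms(3) and v = assms(4)
  have Hu: "smooth_unit_field H" using H by (rule hopf_field_smooth_unit_field)
  obtain b :: "nat \<Rightarrow> 'a" where b: "onb b" "bij_betw b {..<DIM('a)} Basis" by (rule ex_onb_Basis)
  let ?S = "ball 0 1 - {0} :: (real^'a coord) set"
  let ?r = "\<lambda>z. from_coords b z /\<^sub>R norm z"
  let ?C = "real (2 * n choose n)"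
  let ?V = "unit_ball_vol (2 * (n + 1))"
  define d where "d = (\<lambda>z. Determinants.det (matrix (\<lambda>h. to_coords b
     ((from_coords b h \<bullet> ?r z) *\<^sub>R v (?r z) + sphere_deriv v (?r z) (from_coords b h)))))"
  have r: "?r z \<in> sphere 0 1" if "z \<in> ?S" for z
    using that by (simp add: norm_from_coords[OF b(1)])
  have d: "(d has_integral ?V) ?S"
    unfolding d_def by (rule integral_det_unit_field[OF _ v b(1)]) (use DIM in simp)
  note Iv = sphere_measure_integral[OF continuous_on_wedge_norm2[OF v b(1), of n] b]
  note IH = sphere_measure_integral[OF continuous_on_wedge_norm2[OF Hu b(1), of n] b]
  \<comment> \<open>The constant 1 has the same integral as \<open>d\<close>. As the integrand of
    the Hopf field is constant, both functionals can be compared through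
    \<open>?C * ?V\<close>.\<close>
  have one: "((\<lambda>z. 1) has_integral ?V) ?S"
  proof -
    have S: "?S \<in> lmeasurable" by (intro lmeasurable_open bounded_Int bounded_diff) auto
    have "((\<lambda>z. 1 :: real) has_integral measure lebesgue ?S) ?S"
      unfolding lmeasure_integral[OF S] by (rule integrable_integral[OF integrable_on_const[OF S]])
    moreover have "measure lebesgue ?S = measure lebesgue (ball 0 1 :: (real^'a coord) set)"
      by (rule measure_Diff_null_set) auto
    moreover have "\<dots> = measure lborel (ball 0 1 :: (real^'a coord) set)"
      by (rule measure_completion) simp
    moreover have "\<dots> = ?V"
      using content_ball[of 1 "0 :: real^'a coord"] DIM by (simp add: card_coord)
    ultimately show ?thesis by (simp only:)
  qed
  have "integral ?S (\<lambda>z. wedge_norm2 n H (?r z)) = integral ?S (\<lambda>z. ?C)"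
    by (rule integral_cong) (rule wedge_norm2_hopf[OF DIM H r])
  also have "\<dots> = ?C * ?V"
    using has_integral_mult_right[OF one, of ?C] by (simp add: integral_unique)
  also have "\<dots> \<le> integral ?S (\<lambda>z. wedge_norm2 n v (?r z))"
  proof (rule has_integral_le)
    show "((\<lambda>z. ?C * d z) has_integral ?C * ?V) ?S" using d by (rule has_integral_mult_right)
    show "((\<lambda>z. wedge_norm2 n v (?r z)) has_integral integral ?S (\<lambda>z. wedge_norm2 n v (?r z))) ?S"
      using Iv(1) by (rule integrable_integral)
    fix z assume "z \<in> ?S"
    \<comment> \<open>The determinant may be negative: the pointwise bound concerns its absolute
      value, while the known integral is that of \<open>d\<close> itself.\<close>
    have "?C * d z \<le> ?C * \<bar>d z\<bar>" by (intro mult_left_mono) auto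
    also have "\<dots> \<le> wedge_norm2 n v (?r z)"
      unfolding d_def by (rule wedge_norm2_ge_det[OF DIM v r[OF \<open>z \<in> ?S\<close>] b(1)])
    finally show "?C * d z \<le> wedge_norm2 n v (?r z)" .
  qed
  finally show ?thesis
    unfolding B_functional_def Iv(2) IH(2) by (intro mult_left_mono) auto
qed

end
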